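(* Let $A$ be a bounded anti-linear operator on a Hilbert space $X$ which is symmetric, i.e. $\langle Af,g\rangle=\langle Ag,f\rangle$ for all $f,g\in X$. Assume that $|A|$ has simple spectrum with a cyclic element $v$, and let $\rho=\rho^{|A|}_v$ be the spectral measure of $|A|$ corresponding to $v$. Then there exists a unimodular Borel function $\psi$ such that $A$ is unitarily equivalent to the anti-linear operator $\mathcal A$ on $L^2(\rho)$, $$\mathcal A f(s)=s\,\psi(s)\,\overline{f(s)},\qquad f\in L^2(\rho),$$ where the unitary operator $U:L^2(\rho)\to X$ with $AU=U\mathcal A$ is given by $Uf=f(|A|)v$ (defined initially on polynomials $f$ and extended by continuity).
   Context: For a bounded symmetric anti-linear operator $A$, one has $\langle A^2f,f\rangle=\langle Af,Af\rangle\ge 0$, so $A^2$ is a bounded linear positive semi-definite operator; $|A|:=(A^2)^{1/2}$ is its non-negative square root (a linear operator). A bounded self-adjoint operator $B$ on $X$ has simple spectrum with cyclic element $v$ if the closed linear span of $\{B^nv:n\ge0\}$ is $X$. The spectral measure $\rho^B_v$ is the finite Borel measure on $\mathbb R$ with $\langle f(B)v,v\rangle=\int_{\mathbb R} f(s)\,d\rho_v^B(s)$ for every continuous $f$. Unimodular means complex-valued of modulus one. *)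

theory Defs
  imports "HOL-Analysis.Analysis" "HOL-Computational_Algebra.Polynomial"
begin

section \<open>Complex Hilbert spaces\<close>

text \<open>The inner product is linear in the first and conjugate-linear in the second argument;
  positive definiteness is contained in \<open>cinner_self\<close>.\<close>

class complex_hilbert = banach +
  fixes scaleC :: "complex \<Rightarrow> 'a \<Rightarrow> 'a" (infixr "*\<^sub>C" 75)
    and cinner :: "'a \<Rightarrow> 'a \<Rightarrow> complex"
  assumes scaleC_add_right: "c *\<^sub>C (x + y) = c *\<^sub>C x + c *\<^sub>C y"
    and scaleC_add_left: "(c + d) *\<^sub>C x = c *\<^sub>C x + d *\<^sub>C x"
    and scaleC_scaleC: "c *\<^sub>C d *\<^sub>C x = (c * d) *\<^sub>C x"
    and scaleR_scaleC: "r *\<^sub>R x = complex_of_real r *\<^sub>C x"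
    and cinner_commute: "cinner x y = cnj (cinner y x)"
    and cinner_add_left: "cinner (x + y) z = cinner x z + cinner y z"
    and cinner_scaleC_left: "cinner (c *\<^sub>C x) y = c * cinner x y"
    and cinner_self: "cinner x x = complex_of_real ((norm x)\<^sup>2)"


section \<open>Operators\<close>

text \<open>\<open>bounded_linear\<close> means boundedness and linearity over the reals.\<close>

definition bounded_clinear :: "('a::complex_hilbert \<Rightarrow> 'a) \<Rightarrow> bool" where
  "bounded_clinear B \<longleftrightarrow> bounded_linear B \<and> (\<forall>c x. B (c *\<^sub>C x) = c *\<^sub>C B x)"

definition bounded_antilinear :: "('a::complex_hilbert \<Rightarrow> 'a) \<Rightarrow> bool" where
  "bounded_antilinear A \<longleftrightarrow> bounded_linear A \<and> (\<forall>c x. A (c *\<^sub>C x) = cnj c *\<^sub>C A x)"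

definition antilinear_symmetric :: "('a::complex_hilbert \<Rightarrow> 'a) \<Rightarrow> bool" where
  "antilinear_symmetric A \<longleftrightarrow> (\<forall>f g. cinner (A f) g = cinner (A g) f)"

definition positive_semidefinite :: "('a::complex_hilbert \<Rightarrow> 'a) \<Rightarrow> bool" where
  "positive_semidefinite B \<longleftrightarrow> (\<forall>x. cinner (B x) x \<in> \<real>\<^sub>\<ge>\<^sub>0)"

text \<open>The square root is meaningful for bounded linear positive semi-definite operators, for which
  it exists and is unique.\<close>

definition op_sqrt :: "('a::complex_hilbert \<Rightarrow> 'a) \<Rightarrow> 'a \<Rightarrow> 'a" where
  "op_sqrt T = (THE B. bounded_clinear B \<and> positive_semidefinite B \<and> B \<circ> B = T)"

definition abs_op :: "('a::complex_hilbert \<Rightarrow> 'a) \<Rightarrow> 'a \<Rightarrow> 'a" where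
  "abs_op A = op_sqrt (A \<circ> A)"

definition cyclic :: "('a::complex_hilbert \<Rightarrow> 'a) \<Rightarrow> 'a \<Rightarrow> bool" where
  "cyclic B v \<longleftrightarrow> closure (module.span scaleC (range (\<lambda>n::nat. (B ^^ n) v))) = UNIV"


section \<open>Functional calculus and spectral measure\<close>

definition poly_op :: "complex poly \<Rightarrow> ('a::complex_hilbert \<Rightarrow> 'a) \<Rightarrow> 'a \<Rightarrow> 'a" where
  "poly_op p B x = (\<Sum>i\<le>degree p. coeff p i *\<^sub>C (B ^^ i) x)"

text \<open>For bounded self-adjoint \<open>B\<close> and continuous \<open>f\<close>, the operator \<open>f(B)\<close> is the limit in operator
  norm of \<open>p\<^sub>n(B)\<close> for any polynomials \<open>p\<^sub>n\<close> converging to \<open>f\<close> uniformly on the interval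
  \<open>[-\<parallel>B\<parallel>, \<parallel>B\<parallel>]\<close>, which contains the spectrum of \<open>B\<close>. Such polynomials exist by Weierstrass
  approximation, so \<open>f(B)\<close> is unique.\<close>

definition fun_op :: "(real \<Rightarrow> complex) \<Rightarrow> ('a::complex_hilbert \<Rightarrow> 'a) \<Rightarrow> 'a \<Rightarrow> 'a" where
  "fun_op f B = (THE T. bounded_clinear T \<and>
     (\<forall>p :: nat \<Rightarrow> complex poly.
        uniform_limit {- onorm B .. onorm B} (\<lambda>n s. poly (p n) (complex_of_real s)) f sequentially \<longrightarrow>
        (\<lambda>n. onorm (\<lambda>x. poly_op (p n) B x - T x)) \<longlonglongrightarrow> 0))"

text \<open>\<open>has_bochner_integral\<close> comprises the integrability of \<open>f\<close>, which is automatic for the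
  spectral measure since it has compact support.\<close>

definition is_spectral_measure ::
    "('a::complex_hilbert \<Rightarrow> 'a) \<Rightarrow> 'a \<Rightarrow> real measure \<Rightarrow> bool" where
  "is_spectral_measure B v \<rho> \<longleftrightarrow> finite_measure \<rho> \<and> sets \<rho> = sets borel \<and>
     (\<forall>f :: real \<Rightarrow> complex. continuous_on UNIV f \<longrightarrow>
        has_bochner_integral \<rho> f (cinner (fun_op f B v) v))"


section \<open>The space of square-integrable functions\<close>

text \<open>Elements of the Hilbert space \<open>L\<^sup>2(\<rho>)\<close> are given by representatives: a map on the quotient by
  almost-everywhere equality is a map on \<open>L2 \<rho>\<close> which respects this equality.\<close>

definition L2 :: "real measure \<Rightarrow> (real \<Rightarrow> complex) set" where
  "L2 \<rho> = {f. f \<in> borel_measurable \<rho> \<and> integrable \<rho> (\<lambda>s. (cmod (f s))\<^sup>2)}"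

definition unitary_from_L2 ::
    "real measure \<Rightarrow> ((real \<Rightarrow> complex) \<Rightarrow> 'a::complex_hilbert) \<Rightarrow> bool" where
  "unitary_from_L2 \<rho> U \<longleftrightarrow>
     (\<forall>f\<in>L2 \<rho>. \<forall>g\<in>L2 \<rho>. (AE s in \<rho>. f s = g s) \<longrightarrow> U f = U g) \<and>
     (\<forall>f\<in>L2 \<rho>. \<forall>g\<in>L2 \<rho>. U (\<lambda>s. f s + g s) = U f + U g) \<and>
     (\<forall>c. \<forall>f\<in>L2 \<rho>. U (\<lambda>s. c * f s) = c *\<^sub>C U f) \<and>
     (\<forall>f\<in>L2 \<rho>. \<forall>g\<in>L2 \<rho>. cinner (U f) (U g) = (LINT s|\<rho>. f s * cnj (g s))) \<and>
     U ` L2 \<rho> = UNIV"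

definition model_op :: "(real \<Rightarrow> complex) \<Rightarrow> (real \<Rightarrow> complex) \<Rightarrow> real \<Rightarrow> complex" where
  "model_op \<psi> f s = complex_of_real s * \<psi> s * cnj (f s)"

end

(* The absolute value |A| is a norm limit of polynomials in A^2, so it commutes with A, and
   |A f| and A f have equal norm. Sending p to p(|A|)v is isometric from polynomials in L^2(rho)
   and extends to a unitary U that turns |A| into multiplication by s. Write A v = U phi.
   By antilinearity A p(|A|)v = conj(p)(|A|) A v = U(phi conj(p)), so A becomes f -> phi conj(f);
   comparing norms with |A| on indicator functions gives |phi(s)| = |s| almost everywhere, and
   psi(s) = phi(s)/s. *)

theory Submission
  imports Defs "HOL-Computational_Algebra.Fundamental_Theorem_Algebra"
begin

section \<open>Hilbert space basics\<close>

text \<open>\<open>abs_op\<close> and \<open>fun_op\<close> are definite descriptions, so existence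
  and uniqueness of square roots and of f(B) must be settled before either can be used. Everything
  rests on one estimate: if B is self-adjoint with numerical range in [a,b], then ||q(B)|| is at
  most the supremum of |q| on [a,b]. It is obtained without resolvents, by factoring a complex
  polynomial. The interval is left free because the square root needs [0,b], where sqrt(s)^2 = s and
  sqrt(s^2) = s, while the functional calculus is tied to [-||B||, ||B||]. Two more obstacles shape
  the proof. The definition of a spectral measure prescribes integrals but no support, so bounded
  support has to be extracted from them. And f -> phi conj(f) is not known to be bounded when it
  first appears, so the passage from polynomials to all f goes through almost everywhere convergent
  subsequences instead of continuity.\<close>

interpretation scaleC: vector_space "scaleC :: complex \<Rightarrow> 'a::complex_hilbert \<Rightarrow> 'a"
proof
  show "1 *\<^sub>C x = x" for x :: 'a
    by (metis of_real_1 scaleR_one scaleR_scaleC)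
qed (simp_all add: scaleC_add_right scaleC_add_left scaleC_scaleC)

lemma cinner_add_right: "cinner x (y + z) = cinner x y + cinner x z"
  by (metis cinner_commute cinner_add_left complex_cnj_add)

lemma cinner_scaleC_right: "cinner x (c *\<^sub>C y) = cnj c * cinner x y"
  by (metis cinner_commute cinner_scaleC_left complex_cnj_mult)

lemma cinner_0_left [simp]: "cinner 0 y = 0"
  using cinner_scaleC_left[of 0 0 y] by simp

lemma cinner_0_right [simp]: "cinner x 0 = 0"
  using cinner_scaleC_right[of x 0 0] by simp

lemma cinner_diff_left: "cinner (x - y) z = cinner x z - cinner y z"
  by (metis add_diff_cancel_right' cinner_add_left diff_add_cancel)

lemma cmod_power2_of_real: "(complex_of_real (cmod c))\<^sup>2 = c * cnj c"
  by (metis complex_norm_square of_real_power)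

lemma norm_scaleC: "norm (c *\<^sub>C x) = cmod c * norm (x::'a::complex_hilbert)"
proof -
  have "complex_of_real ((norm (c *\<^sub>C x))\<^sup>2) = of_real ((cmod c * norm x)\<^sup>2)"
    by (simp only: cinner_self[symmetric] cinner_scaleC_left cinner_scaleC_right)
      (simp add: cinner_self cmod_power2_of_real power_mult_distrib mult_ac)
  then have "(norm (c *\<^sub>C x))\<^sup>2 = (cmod c * norm x)\<^sup>2"
    using of_real_eq_iff by blast
  then show ?thesis
    by (simp add: power2_eq_iff_nonneg)
qed

lemma norm_add_square:
  "(norm (x + y))\<^sup>2 = (norm x)\<^sup>2 + 2 * Re (cinner x y) + (norm (y::'a::complex_hilbert))\<^sup>2"
proof -
  have "complex_of_real ((norm (x + y))\<^sup>2) = (norm x)\<^sup>2 + (cinner x y + cnj (cinner x y)) + (norm y)\<^sup>2"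
    unfolding cinner_self[symmetric] cinner_add_left cinner_add_right
    by (simp add: cinner_self cinner_commute[of y x])
  then show ?thesis
    unfolding complex_add_cnj of_real_add[symmetric] of_real_eq_iff by simp
qed

lemma norm_diff_square:
  "(norm (x - y))\<^sup>2 = (norm x)\<^sup>2 - 2 * Re (cinner x y) + (norm (y::'a::complex_hilbert))\<^sup>2"
  using norm_add_square[of "x - y" y]
  by (simp add: cinner_diff_left cinner_self power2_eq_square)

lemma Cauchy_Schwarz_cinner: "cmod (cinner x y) \<le> norm x * norm (y::'a::complex_hilbert)"
proof (cases "y = 0")
  case False
  define t where "t = cinner x y"
  define n where "n = norm y"
  have n: "n > 0" using False by (simp add: n_def)
  \<comment> \<open>The multiple of \<open>y\<close> used here is the orthogonal projection of
    \<open>x\<close> onto \<open>y\<close>; the inequality is nonnegativity of the squared distance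
    from \<open>x\<close> to it.\<close>
  have "Re (cinner x ((t / of_real (n\<^sup>2)) *\<^sub>C y)) = (cmod t)\<^sup>2 / n\<^sup>2"
    unfolding cinner_scaleC_right t_def[symmetric]
    by (simp add: complex_norm_square[symmetric] mult.commute Re_divide_of_real flip: of_real_power)
  moreover have "(norm ((t / of_real (n\<^sup>2)) *\<^sub>C y))\<^sup>2 = (cmod t)\<^sup>2 / n\<^sup>2"
    unfolding norm_scaleC using n
    by (simp add: n_def[symmetric] norm_divide norm_mult power2_eq_square)
  ultimately have "0 \<le> (norm x)\<^sup>2 - (cmod t)\<^sup>2 / n\<^sup>2"
    using norm_diff_square[of x "(t / of_real (n\<^sup>2)) *\<^sub>C y"]
      zero_le_power2[of "norm (x - (t / of_real (n\<^sup>2)) *\<^sub>C y)"] by linarith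
  then have "(cmod t)\<^sup>2 / n\<^sup>2 \<le> (norm x)\<^sup>2"
    by simp
  then have "(cmod t)\<^sup>2 \<le> (norm x * n)\<^sup>2"
    using n by (simp only: power_mult_distrib pos_divide_le_eq zero_less_power)
  then have "cmod t \<le> norm x * n"
    using n by (intro power2_le_imp_le[of "cmod t"]) auto
  then show ?thesis
    by (simp only: t_def n_def)
qed simp

lemma bounded_bilinear_cinner: "bounded_bilinear (cinner :: 'a::complex_hilbert \<Rightarrow> 'a \<Rightarrow> complex)"
proof
  show "\<exists>K. \<forall>a b. norm (cinner a b) \<le> norm (a::'a) * norm (b::'a) * K"
    using Cauchy_Schwarz_cinner by (intro exI[of _ 1]) auto
qed (simp_all add: cinner_add_left cinner_add_right scaleR_scaleC cinner_scaleC_left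
    cinner_scaleC_right scaleR_conv_of_real)

lemmas tendsto_cinner = bounded_bilinear.tendsto[OF bounded_bilinear_cinner]

lemma tendsto_scaleC:
  assumes "(x \<longlongrightarrow> (y::'a::complex_hilbert)) F"
  shows "((\<lambda>i. c *\<^sub>C x i) \<longlongrightarrow> c *\<^sub>C y) F"
proof -
  have "bounded_linear (\<lambda>x::'a. c *\<^sub>C x)"
    by (rule bounded_linear_intro[of _ "cmod c"])
      (simp_all add: scaleC_add_right scaleR_scaleC scaleC_scaleC mult.commute norm_scaleC)
  then show ?thesis using assms by (rule bounded_linear.tendsto)
qed

text \<open>Serves to upgrade preservation of norms to preservation of inner products in
  \<open>U_cinner\<close>. Signs are written as scalars -1 and -i so that the terms fit the shape
  \<open>x + c *\<^sub>C y\<close>.\<close>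

lemma cinner_polarization:
  "4 * cinner x y = of_real ((norm (x + y))\<^sup>2) - of_real ((norm (x + (-1) *\<^sub>C y))\<^sup>2)
     + \<i> * of_real ((norm (x + \<i> *\<^sub>C y))\<^sup>2) - \<i> * of_real ((norm (x + (-\<i>) *\<^sub>C y))\<^sup>2)"
  unfolding cinner_self[symmetric] cinner_add_left cinner_add_right cinner_scaleC_left cinner_scaleC_right
  by (simp add: algebra_simps)

section \<open>Polynomials of an operator\<close>

lemma bounded_clinearD:
  assumes "bounded_clinear B"
  shows "bounded_linear B" "B (c *\<^sub>C x) = c *\<^sub>C B x" "B (x + y) = B x + B y" "B (x - y) = B x - B y"
    "B 0 = 0"
  using assms unfolding bounded_clinear_def
  by (auto simp: linear_simps)

lemma bounded_clinear_comp: "bounded_clinear S \<Longrightarrow> bounded_clinear T \<Longrightarrow> bounded_clinear (\<lambda>x. S (T x))"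
  unfolding bounded_clinear_def by (auto intro: bounded_linear_compose)

lemma bounded_clinear_add: "bounded_clinear S \<Longrightarrow> bounded_clinear T \<Longrightarrow> bounded_clinear (\<lambda>x. S x + T x)"
  unfolding bounded_clinear_def by (auto intro: bounded_linear_add simp: scaleC_add_right)

lemma bounded_clinear_diff: "bounded_clinear S \<Longrightarrow> bounded_clinear T \<Longrightarrow> bounded_clinear (\<lambda>x. S x - T x)"
  unfolding bounded_clinear_def by (auto intro: bounded_linear_sub simp: scaleC.scale_right_diff_distrib)

lemma bounded_clinear_scaleC: "bounded_clinear (\<lambda>x. c *\<^sub>C x)"
  unfolding bounded_clinear_def
  by (auto simp: scaleC_scaleC mult.commute scaleC_add_right scaleR_scaleC norm_scaleC
      intro!: bounded_linear_intro[of _ "cmod c"])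

lemma bounded_clinear_norm_le:
  assumes "bounded_clinear B" shows "norm (B x) \<le> onorm B * norm x"
  using onorm[OF bounded_clinearD(1)[OF assms]] .

lemma poly_op_0 [simp]: "poly_op 0 B x = 0"
  by (simp add: poly_op_def)

text \<open>Horner's recursion: it replaces the power sum and opens the way to induction over
  \<open>pCons\<close> for sums, multiples and products.\<close>

lemma poly_op_pCons:
  assumes "bounded_clinear B"
  shows "poly_op (pCons a p) B x = a *\<^sub>C x + B (poly_op p B x)"
\<comment> \<open>Prepending a coefficient raises the degree only if \<open>p\<close> is
  nonzero.\<close>
proof (cases "p = 0")
  case True
  then show ?thesis
    by (simp add: poly_op_def bounded_clinearD(5)[OF assms])
next
  case False
  have "B (poly_op p B x) = (\<Sum>i\<le>degree p. coeff p i *\<^sub>C (B ^^ Suc i) x)"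
    unfolding poly_op_def
    using bounded_linear.linear[OF bounded_clinearD(1)[OF assms]]
    by (simp add: linear_sum bounded_clinearD(2)[OF assms])
  then show ?thesis
    unfolding poly_op_def using False by (simp add: sum.atMost_Suc_shift del: sum.atMost_Suc)
qed

lemma poly_op_const: "poly_op [:a:] B x = a *\<^sub>C x"
  by (simp add: poly_op_def)

lemma poly_op_X: "poly_op [:0, 1:] B x = B x"
  by (simp add: poly_op_def)

lemma poly_op_add:
  assumes "bounded_clinear B"
  shows "poly_op (p + q) B x = poly_op p B x + poly_op q B x"
  by (induction p q rule: poly_induct2)
    (simp_all add: poly_op_pCons[OF assms] scaleC_add_left bounded_clinearD[OF assms])

lemma poly_op_smult:
  assumes "bounded_clinear B"
  shows "poly_op (smult c p) B x = c *\<^sub>C poly_op p B x"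
  by (induction p)
    (simp_all add: poly_op_pCons[OF assms] scaleC_scaleC scaleC_add_right bounded_clinearD[OF assms])

lemma poly_op_diff:
  assumes "bounded_clinear B"
  shows "poly_op (p - q) B x = poly_op p B x - poly_op q B x"
  using poly_op_add[OF assms, of "p - q" q x] by simp

lemma poly_op_mult:
  assumes "bounded_clinear B"
  shows "poly_op (p * q) B x = poly_op p B (poly_op q B x)"
  by (induction p)
    (simp_all add: poly_op_pCons[OF assms] poly_op_add[OF assms] poly_op_smult[OF assms])

lemma bounded_clinear_poly_op:
  assumes "bounded_clinear B"
  shows "bounded_clinear (poly_op p B)"
proof (induction p)
  case 0
  show ?case by (simp add: bounded_clinear_def)
next
  case (pCons a p)
  then show ?case
    unfolding poly_op_pCons[OF assms, abs_def]
    by (intro bounded_clinear_add bounded_clinear_scaleC bounded_clinear_comp[OF assms])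
qed

text \<open>Prepares uniqueness of the square root: polynomials in the square of a root become
  polynomials in the root itself.\<close>

lemma poly_op_pcompose_square:
  assumes "bounded_clinear B"
  shows "poly_op (pcompose p [:0, 0, 1:]) B x = poly_op p (\<lambda>x. B (B x)) x"
proof -
  have B2: "bounded_clinear (\<lambda>x. B (B x))"
    by (rule bounded_clinear_comp[OF assms assms])
  show ?thesis
    by (induction p)
      (simp_all add: poly_op_pCons[OF assms] poly_op_pCons[OF B2] pcompose_pCons poly_op_add[OF assms]
        poly_op_mult[OF assms] bounded_clinearD[OF assms])
qed

lemma map_poly_cnj_pCons [simp]: "map_poly cnj (pCons a p) = pCons (cnj a) (map_poly cnj p)"
  by (rule map_poly_pCons) simp

lemma map_poly_cnj_mult: "map_poly cnj (p * q) = map_poly cnj p * map_poly cnj q"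
  by (rule poly_eqI) (simp add: coeff_map_poly coeff_mult cnj_sum)

text \<open>Each coefficient is conjugated as \<open>A\<close> passes it. Used for real polynomials
  in \<open>A \<circ> A\<close>, where nothing changes, and for arbitrary polynomials in |A|, where
  this is the origin of conj(f) in the model.\<close>

lemma poly_op_antilinear:
  assumes B: "bounded_clinear B" and A: "bounded_antilinear A" and comm: "\<And>x. A (B x) = B (A x)"
  shows "A (poly_op p B x) = poly_op (map_poly cnj p) B (A x)"
proof -
  have "bounded_linear A" and [simp]: "A (c *\<^sub>C x) = cnj c *\<^sub>C A x" for c x
    using A by (simp_all add: bounded_antilinear_def)
  then have [simp]: "A (x + y) = A x + A y" "A 0 = 0" for x y
    by (simp_all add: linear_simps)
  show ?thesis
    by (induction p) (simp_all add: poly_op_pCons[OF B] comm)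
qed

section \<open>Self-adjoint operators, approximate eigenvalues and the numerical range\<close>

definition self_adjoint :: "('a::complex_hilbert \<Rightarrow> 'a) \<Rightarrow> bool" where
  "self_adjoint B \<longleftrightarrow> bounded_clinear B \<and> (\<forall>x y. cinner (B x) y = cinner x (B y))"

lemma self_adjointD:
  assumes "self_adjoint B"
  shows "bounded_clinear B" "cinner (B x) y = cinner x (B y)"
  using assms by (simp_all add: self_adjoint_def)

lemma cinner_poly_op:
  assumes "self_adjoint B"
  shows "cinner (poly_op p B x) y = cinner x (poly_op (map_poly cnj p) B y)"
proof (induction p arbitrary: y)
  case (pCons a p)
  have B: "bounded_clinear B" using assms by (rule self_adjointD)
  \<comment> \<open>\<open>B\<close> commutes with its own polynomials because polynomial
    multiplication is commutative.\<close>
  have "poly_op (map_poly cnj p) B (B y) = B (poly_op (map_poly cnj p) B y)" for p y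
    using poly_op_mult[OF B, of "map_poly cnj p" "[:0,1:]" y] poly_op_mult[OF B, of "[:0,1:]" "map_poly cnj p" y]
    by (simp add: poly_op_X mult.commute)
  then show ?case
    by (simp add: poly_op_pCons[OF B] cinner_add_left cinner_add_right cinner_scaleC_left cinner_scaleC_right
        self_adjointD[OF assms] pCons.IH)
qed simp

lemma self_adjoint_cinner_real:
  assumes "self_adjoint B"
  shows "Im (cinner (B x) x) = 0"
proof -
  have "cinner (B x) x = cnj (cinner (B x) x)"
    using cinner_commute[of "B x" x] self_adjointD(2)[OF assms, of x x] by simp
  then have "Im (cinner (B x) x) = - Im (cinner (B x) x)"
    by (metis cnj.simps(2))
  then show ?thesis by simp
qed

text \<open>Complex scalars are essential: testing the form on x + y and on x + iy kills the
  imaginary and the real part of <Bx,y> - <x,By>.\<close>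

lemma cinner_real_imp_self_adjoint:
  assumes B: "bounded_clinear B" and re: "\<And>x. Im (cinner (B x) x) = 0"
  shows "self_adjoint B"
proof -
  have "cinner (B x) y = cinner x (B y)" for x y
  proof -
    define a where "a = cinner (B x) y"
    define b where "b = cinner (B y) x"
    have "Im (a + b) = 0"
      using re[of "x + y"] re[of x] re[of y]
      by (simp add: a_def b_def bounded_clinearD[OF B] cinner_add_left cinner_add_right)
    moreover have "Im (- \<i> * a + \<i> * b) = 0"
      using re[of "x + \<i> *\<^sub>C y"] re[of x] re[of y]
      by (simp add: a_def b_def bounded_clinearD[OF B] cinner_add_left cinner_add_right
          cinner_scaleC_left cinner_scaleC_right)
    ultimately have "a = cnj b"
      by (simp add: complex_eq_iff)
    then show ?thesis
      unfolding a_def b_def using cinner_commute by metis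
  qed
  then show ?thesis
    using B by (simp add: self_adjoint_def)
qed

text \<open>For \<open>\<lambda>x. B x - r *\<^sub>C x\<close>, failure of this property says that
  \<open>r\<close> is an approximate eigenvalue of \<open>B\<close>. No other part of the spectrum
  enters the argument.\<close>

definition bounded_below :: "('a::real_normed_vector \<Rightarrow> 'b::real_normed_vector) \<Rightarrow> bool" where
  "bounded_below T \<longleftrightarrow> (\<exists>c>0. \<forall>x. c * norm x \<le> norm (T x))"

lemma bounded_below_comp:
  assumes "bounded_below S" "bounded_below T"
  shows "bounded_below (\<lambda>x. S (T x))"
proof -
  obtain c d where c: "c > 0" "\<And>x. c * norm x \<le> norm (S x)" and d: "d > 0" "\<And>x. d * norm x \<le> norm (T x)"
    using assms unfolding bounded_below_def by metis
  have "c * d * norm x \<le> norm (S (T x))" for x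
    using order_trans[OF mult_left_mono[OF d(2)[of x], of c] c(2)[of "T x"]] c(1) by (simp add: mult.assoc)
  then show ?thesis
    unfolding bounded_below_def using c(1) d(1) by (intro exI[of _ "c * d"]) simp
qed

text \<open>Up to a nonzero scalar, h(B) is the product of the factors B - r over the roots of h.
  Products of maps bounded below are bounded below, so some factor must fail to be.\<close>

lemma not_bounded_below_imp_root:
  assumes "bounded_clinear B" "h \<noteq> 0" "\<not> bounded_below (poly_op h B)"
  shows "\<exists>r. poly h r = 0 \<and> \<not> bounded_below (\<lambda>x. B x - r *\<^sub>C x)"
  using assms(2,3)
proof (induction "degree h" arbitrary: h)
  case 0
  then obtain c where c: "h = [:c:]" "c \<noteq> 0"
    by (metis degree_eq_zeroE pCons_0_0)
  have "bounded_below (poly_op h B)"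
    unfolding bounded_below_def using c by (intro exI[of _ "cmod c"]) (simp add: poly_op_const norm_scaleC)
  with 0 show ?case by simp
next
  case (Suc n)
  then have "\<not> constant (poly h)"
    by (simp add: constant_degree)
  then obtain r where r: "poly h r = 0"
    using fundamental_theorem_of_algebra by blast
  then obtain g where g: "h = [:- r, 1:] * g"
    by (metis poly_eq_0_iff_dvd dvd_def)
  with Suc have g0: "g \<noteq> 0" by auto
  have dg: "n = degree g"
    using Suc(2) g0 unfolding g by (subst (asm) degree_mult_eq) auto
  have "poly_op h B = (\<lambda>x. B (poly_op g B x) - r *\<^sub>C poly_op g B x)"
    unfolding g poly_op_mult[OF assms(1), abs_def]
    by (simp add: poly_op_pCons[OF assms(1)] bounded_clinearD[OF assms(1)])
  with Suc.prems(2) have "\<not> bounded_below (\<lambda>x. B x - r *\<^sub>C x) \<or> \<not> bounded_below (poly_op g B)"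
    using bounded_below_comp[of "\<lambda>x. B x - r *\<^sub>C x" "poly_op g B"] by auto
  then show ?case
    using r Suc.hyps(1)[OF dg g0] by (auto simp: g)
qed

lemma bounded_belowI_cinner:
  fixes T :: "'a::complex_hilbert \<Rightarrow> 'a"
  assumes "c > 0" "\<And>x. c * (norm x)\<^sup>2 \<le> cmod (cinner (T x) x)"
  shows "bounded_below T"
proof -
  have "c * norm x \<le> norm (T x)" for x
  proof (cases "x = 0")
    case False
    have "(c * norm x) * norm x \<le> norm (T x) * norm x"
      using order_trans[OF assms(2)[of x] Cauchy_Schwarz_cinner] by (simp add: power2_eq_square mult.assoc)
    then show ?thesis using False by simp
  qed simp
  with assms(1) show ?thesis unfolding bounded_below_def by blast
qed

text \<open>The form of B - r is <Bx,x> - r||x||^2 with <Bx,x> real and between a||x||^2 and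
  b||x||^2. Its modulus is therefore at least |Im r|, a - Re r and Re r - b times ||x||^2, and one
  of these factors is positive.\<close>

lemma bounded_below_outside_numerical_range:
  assumes sa: "self_adjoint B"
    and ab: "\<And>x. a * (norm x)\<^sup>2 \<le> Re (cinner (B x) x)" "\<And>x. Re (cinner (B x) x) \<le> b * (norm x)\<^sup>2"
    and r: "\<not> (Im r = 0 \<and> a \<le> Re r \<and> Re r \<le> b)"
  shows "bounded_below (\<lambda>x. B x - r *\<^sub>C x)"
proof -
  have ip: "cinner (B x - r *\<^sub>C x) x = cinner (B x) x - r * of_real ((norm x)\<^sup>2)" for x
    by (simp add: cinner_diff_left cinner_scaleC_left cinner_self)
  have im: "\<bar>Im r\<bar> * (norm x)\<^sup>2 \<le> cmod (cinner (B x - r *\<^sub>C x) x)" for x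
    using abs_Im_le_cmod[of "cinner (B x - r *\<^sub>C x) x"]
    unfolding ip by (simp add: self_adjoint_cinner_real[OF sa] abs_mult flip: of_real_power)
  have re: "\<bar>Re (cinner (B x) x) - Re r * (norm x)\<^sup>2\<bar> \<le> cmod (cinner (B x - r *\<^sub>C x) x)" for x
    using abs_Re_le_cmod[of "cinner (B x - r *\<^sub>C x) x"]
    unfolding ip by (simp flip: of_real_power)
  consider "Im r \<noteq> 0" | "Re r < a" | "Re r > b" using r by linarith
  then show ?thesis
  proof cases
    case 1
    then show ?thesis using im by (intro bounded_belowI_cinner[of "\<bar>Im r\<bar>"]) auto
  next
    case 2
    have "(a - Re r) * (norm x)\<^sup>2 \<le> cmod (cinner (B x - r *\<^sub>C x) x)" for x
      using re[of x] ab(1)[of x] by (simp add: left_diff_distrib)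
    then show ?thesis using 2 by (intro bounded_belowI_cinner[of "a - Re r"]) auto
  next
    case 3
    have "(Re r - b) * (norm x)\<^sup>2 \<le> cmod (cinner (B x - r *\<^sub>C x) x)" for x
      using re[of x] ab(2)[of x] by (simp add: left_diff_distrib)
    then show ?thesis using 3 by (intro bounded_belowI_cinner[of "Re r - b"]) auto
  qed
qed

text \<open>If \<open>M = \<parallel>q(B)\<parallel>\<close>, unit vectors almost attaining the norm show that \<open>M\<^sup>2\<close> is an approximate
  eigenvalue of \<open>q(B)\<^sup>* q(B)\<close>. Splitting \<open>q\<^sup>* q - M\<^sup>2\<close> into linear factors, one of its roots \<open>r\<close> must be an
  approximate eigenvalue of \<open>B\<close>, hence lie in the numerical range of \<open>B\<close>, and there \<open>\<bar>q(r)\<bar> = M\<close>.\<close>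

lemma norm_poly_op_le:
  assumes sa: "self_adjoint B"
    and ab: "\<And>x. a * (norm x)\<^sup>2 \<le> Re (cinner (B x) x)" "\<And>x. Re (cinner (B x) x) \<le> b * (norm x)\<^sup>2"
    and le: "a \<le> b"
    and K: "\<And>s. a \<le> s \<Longrightarrow> s \<le> b \<Longrightarrow> cmod (poly q (of_real s)) \<le> K"
  shows "norm (poly_op q B x) \<le> K * norm x"
proof -
  define T where "T = poly_op q B"
  define T' where "T' = poly_op (map_poly cnj q) B"
  define M where "M = onorm T"
  define h where "h = map_poly cnj q * q - [:of_real (M\<^sup>2):]"
  have B: "bounded_clinear B" using sa by (rule self_adjointD)
  have T: "bounded_clinear T" unfolding T_def by (rule bounded_clinear_poly_op[OF B])
  have TM: "norm (T y) \<le> M * norm y" for y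
    unfolding M_def by (rule bounded_clinear_norm_le[OF T])
  have M0: "M \<ge> 0" unfolding M_def by (rule onorm_pos_le[OF bounded_clinearD(1)[OF T]])
  have adj: "cinner (T' y) z = cinner y (T z)" for y z
    unfolding T_def T'_def using cinner_poly_op[OF sa, of "map_poly cnj q" y z]
    by (simp add: map_poly_map_poly o_def)
  \<comment> \<open>The adjoint inherits the bound: ||T'y||^2 = <y, T T'y> is at most ||y|| M
    ||T'y||, and one factor cancels.\<close>
  have T'M: "norm (T' y) \<le> M * norm y" for y
  proof (cases "T' y = 0")
    case False
    have "(norm (T' y))\<^sup>2 = cmod (cinner (T' y) (T' y))"
      by (simp add: cinner_self norm_power)
    also have "\<dots> \<le> norm y * norm (T (T' y))"
      unfolding adj by (rule Cauchy_Schwarz_cinner)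
    also have "\<dots> \<le> norm y * (M * norm (T' y))"
      by (intro mult_left_mono TM) simp
    finally show ?thesis using False by (simp add: power2_eq_square mult_ac)
  qed (simp add: M0)
  have "M \<le> K"
  proof (rule ccontr)
    assume "\<not> M \<le> K"
    \<comment> \<open>The interval contains \<open>a\<close>, so \<open>K\<close> bounds at least
      one modulus.\<close>
    have K0: "K \<ge> 0" using K[of a] le norm_ge_zero order_trans by blast
    with \<open>\<not> M \<le> K\<close> have MK: "M > K" "M > 0" by auto
    \<comment> \<open>At real points the conjugated coefficients produce the conjugated value of
      \<open>q\<close>; hence \<open>h\<close> is |q|^2 - M^2 there, which is negative on [a,b] if K
      < M.\<close>
    have hr: "poly h (of_real s) = of_real ((cmod (poly q (of_real s)))\<^sup>2 - M\<^sup>2)" for s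
      unfolding h_def by (simp add: cmod_power2_of_real mult.commute)
    have hr0: "poly h (of_real s) \<noteq> 0" if s: "a \<le> s" "s \<le> b" for s
    proof -
      have "(cmod (poly q (of_real s)))\<^sup>2 \<le> K\<^sup>2"
        by (intro power_mono K s) simp
      also have "K\<^sup>2 < M\<^sup>2" using MK K0 by (intro power_strict_mono) auto
      finally show ?thesis unfolding hr of_real_eq_0_iff by simp
    qed
    have hB: "poly_op h B y = T' (T y) - of_real (M\<^sup>2) *\<^sub>C y" for y
      unfolding h_def T_def T'_def by (simp only: poly_op_diff[OF B] poly_op_mult[OF B] poly_op_const)
    have "\<not> bounded_below (poly_op h B)"
    proof
      assume "bounded_below (poly_op h B)"
      then obtain c where c: "c > 0" "\<And>y. c * norm y \<le> norm (poly_op h B y)"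
        unfolding bounded_below_def by blast
      \<comment> \<open>Expand ||T'Ty - M^2 y||^2. The cross term is -2 M^2 ||Ty||^2 and the first
        square is at most M^2 ||Ty||^2, so one negative copy survives beside M^4 ||y||^2.\<close>
      have bd: "M\<^sup>2 * (norm (T y))\<^sup>2 \<le> (M^4 - c\<^sup>2) * (norm y)\<^sup>2" for y
      proof -
        have "c\<^sup>2 * (norm y)\<^sup>2 \<le> (norm (T' (T y) - of_real (M\<^sup>2) *\<^sub>C y))\<^sup>2"
          using power_mono[OF c(2)[of y], of 2] c(1) unfolding hB by (simp add: power_mult_distrib)
        also have "\<dots> = (norm (T' (T y)))\<^sup>2 - 2 * M\<^sup>2 * (norm (T y))\<^sup>2 + M^4 * (norm y)\<^sup>2"
        proof -
          have "cinner (T' (T y)) (of_real (M\<^sup>2) *\<^sub>C y) = of_real (M\<^sup>2 * (norm (T y))\<^sup>2)"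
            unfolding cinner_scaleC_right adj by (simp add: cinner_self)
          then show ?thesis
            unfolding norm_diff_square norm_scaleC
            by (simp add: power_mult_distrib norm_power flip: power_mult)
        qed
        also have "(norm (T' (T y)))\<^sup>2 \<le> M\<^sup>2 * (norm (T y))\<^sup>2"
          using power_mono[OF T'M[of "T y"], of 2] by (simp add: power_mult_distrib)
        finally show ?thesis by (simp add: algebra_simps)
      qed
      \<comment> \<open>Since M > 0, some \<open>T y\<close> is nonzero, and there \<open>bd\<close>
        forces its right side to be positive.\<close>
      have pos: "M^4 - c\<^sup>2 \<ge> 0"
      proof -
        have "\<exists>y. T y \<noteq> 0"
          using MK(2) unfolding M_def by (metis onorm_zero ext less_irrefl)
        then obtain y where "T y \<noteq> 0" by blast
        then have "0 < M\<^sup>2 * (norm (T y))\<^sup>2" using MK(2) by simp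
        then have "0 < (M^4 - c\<^sup>2) * (norm y)\<^sup>2" using bd[of y] by linarith
        then show ?thesis by (simp add: zero_less_mult_iff)
      qed
      have "norm (T y) \<le> sqrt ((M^4 - c\<^sup>2) / M\<^sup>2) * norm y" for y
      proof -
        have "(norm (T y))\<^sup>2 \<le> (M^4 - c\<^sup>2) / M\<^sup>2 * (norm y)\<^sup>2"
          using bd[of y] MK(2) by (simp add: field_simps)
        then have "norm (T y) \<le> sqrt ((M^4 - c\<^sup>2) / M\<^sup>2 * (norm y)\<^sup>2)"
          by (rule real_le_rsqrt)
        then show ?thesis by (simp only: real_sqrt_mult real_sqrt_abs abs_norm_cancel)
      qed
      \<comment> \<open>\<open>M\<close> is the least bound for \<open>T\<close>, so this smaller
        bound yields M^4 at most M^4 - c^2, contradicting c > 0.\<close>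
      then have "M \<le> sqrt ((M^4 - c\<^sup>2) / M\<^sup>2)"
        unfolding M_def by (intro onorm_bound) (use pos in \<open>auto simp: M_def\<close>)
      then have "M\<^sup>2 \<le> (sqrt ((M^4 - c\<^sup>2) / M\<^sup>2))\<^sup>2"
        using M0 by (intro power_mono)
      also have "\<dots> = (M^4 - c\<^sup>2) / M\<^sup>2" using pos by simp
      finally have "M\<^sup>2 * M\<^sup>2 \<le> M^4 - c\<^sup>2" using MK(2) by (simp add: field_simps)
      moreover have "M\<^sup>2 * M\<^sup>2 = M^4" by (simp flip: power_add)
      ultimately have "c\<^sup>2 \<le> 0" by simp
      with c(1) show False by simp
    qed
    moreover have "h \<noteq> 0" using hr0[of a] le by auto
    ultimately obtain r where r: "poly h r = 0" "\<not> bounded_below (\<lambda>x. B x - r *\<^sub>C x)"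
      using not_bounded_below_imp_root[OF B] by blast
    from r(2) have "Im r = 0 \<and> a \<le> Re r \<and> Re r \<le> b"
      using bounded_below_outside_numerical_range[OF sa ab] by blast
    then show False using hr0[of "Re r"] r(1) by (simp add: complex_is_Real_iff)
  qed
  then show ?thesis
    using order_trans[OF TM[of x]] by (simp add: T_def mult_right_mono)
qed

section \<open>Well-definedness of the functional calculus\<close>

lemma norm_poly_op_le_onorm:
  assumes sa: "self_adjoint B"
    and K: "\<And>s. s \<in> {- onorm B .. onorm B} \<Longrightarrow> cmod (poly q (of_real s)) \<le> K"
  shows "norm (poly_op q B x) \<le> K * norm x"
proof (rule norm_poly_op_le[OF sa])
  have B: "bounded_clinear B" using sa by (rule self_adjointD)
  have "\<bar>Re (cinner (B y) y)\<bar> \<le> onorm B * (norm y)\<^sup>2" for y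
  proof -
    have "\<bar>Re (cinner (B y) y)\<bar> \<le> norm (B y) * norm y"
      using abs_Re_le_cmod Cauchy_Schwarz_cinner order_trans by blast
    also have "\<dots> \<le> (onorm B * norm y) * norm y"
      by (intro mult_right_mono bounded_clinear_norm_le[OF B]) simp
    finally show ?thesis by (simp add: power2_eq_square mult.assoc)
  qed
  then show "- onorm B * (norm y)\<^sup>2 \<le> Re (cinner (B y) y)" "Re (cinner (B y) y) \<le> onorm B * (norm y)\<^sup>2" for y
    by (simp_all add: abs_le_iff minus_le_iff)
  show "- onorm B \<le> onorm B"
    using onorm_pos_le[OF bounded_clinearD(1)[OF B]] by simp
qed (use K in auto)

text \<open>The description in \<open>fun_op\<close> quantifies over all approximating sequences,
  but one suffices: two sequences with the same uniform limit differ by polynomials that become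
  uniformly small on the interval, hence by operators of small norm.\<close>

lemma fun_op_eqI:
  assumes sa: "self_adjoint B" and T: "bounded_clinear T"
    and p: "uniform_limit {- onorm B .. onorm B} (\<lambda>n s. poly (p n) (complex_of_real s)) f sequentially"
    and lim: "(\<lambda>n. onorm (\<lambda>x. poly_op (p n) B x - T x)) \<longlonglongrightarrow> 0"
  shows "fun_op f B = T"
proof -
  have B: "bounded_clinear B" using sa by (rule self_adjointD)
  have bl: "bounded_linear (\<lambda>x. S x - T x)" if "bounded_clinear S" "bounded_clinear T" for S T :: "'a \<Rightarrow> 'a"
    using bounded_clinear_diff[OF that] by (rule bounded_clinearD)
  have conv: "(\<lambda>n. onorm (\<lambda>x. poly_op (q n) B x - T x)) \<longlonglongrightarrow> 0"
    if q: "uniform_limit {- onorm B .. onorm B} (\<lambda>n s. poly (q n) (complex_of_real s)) f sequentially"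
    for q :: "nat \<Rightarrow> complex poly"
  proof -
    have "(\<lambda>n. onorm (\<lambda>x. poly_op (q n) B x - poly_op (p n) B x)) \<longlonglongrightarrow> 0"
    proof (rule tendstoI)
      fix e :: real assume e: "e > 0"
      have "\<forall>\<^sub>F n in sequentially. \<forall>s\<in>{- onorm B .. onorm B}. dist (poly (p n) (of_real s)) (f s) < e/4"
        using p e by (intro uniform_limitD) auto
      moreover have "\<forall>\<^sub>F n in sequentially. \<forall>s\<in>{- onorm B .. onorm B}. dist (poly (q n) (of_real s)) (f s) < e/4"
        using q e by (intro uniform_limitD) auto
      ultimately show "\<forall>\<^sub>F n in sequentially. dist (onorm (\<lambda>x. poly_op (q n) B x - poly_op (p n) B x)) 0 < e"
      proof eventually_elim
        case (elim n)
        have "cmod (poly (q n - p n) (of_real s)) \<le> e/2" if "s \<in> {- onorm B .. onorm B}" for s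
          using elim[rule_format, OF that] dist_triangle2[of "poly (q n) (of_real s)" "poly (p n) (of_real s)" "f s"]
          by (simp add: dist_norm)
        then have "norm (poly_op (q n - p n) B x) \<le> e/2 * norm x" for x
          by (rule norm_poly_op_le_onorm[OF sa])
        then have "onorm (\<lambda>x. poly_op (q n) B x - poly_op (p n) B x) \<le> e/2"
          using e by (intro onorm_bound) (auto simp: poly_op_diff[OF B])
        moreover have "onorm (\<lambda>x. poly_op (q n) B x - poly_op (p n) B x) \<ge> 0"
          by (intro onorm_pos_le bl bounded_clinear_poly_op B)
        ultimately show ?case using e by simp
      qed
    qed
    then have "(\<lambda>n. onorm (\<lambda>x. poly_op (q n) B x - poly_op (p n) B x)
        + onorm (\<lambda>x. poly_op (p n) B x - T x)) \<longlonglongrightarrow> 0"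
      using tendsto_add[OF _ lim] by fastforce
    then show ?thesis
    proof (rule tendsto_sandwich[OF _ _ tendsto_const, rotated 2])
      show "\<forall>\<^sub>F n in sequentially. 0 \<le> onorm (\<lambda>x. poly_op (q n) B x - T x)"
        by (intro always_eventually allI onorm_pos_le bl bounded_clinear_poly_op B T)
      have "onorm (\<lambda>x. poly_op (q n) B x - T x) \<le> onorm (\<lambda>x. poly_op (q n) B x - poly_op (p n) B x)
          + onorm (\<lambda>x. poly_op (p n) B x - T x)" for n
        using onorm_triangle[OF bl bl, of "poly_op (q n) B" "poly_op (p n) B" "poly_op (p n) B" T]
        by (simp add: bounded_clinear_poly_op B T)
      then show "\<forall>\<^sub>F n in sequentially. onorm (\<lambda>x. poly_op (q n) B x - T x) \<le> onorm (\<lambda>x. poly_op (q n) B x - poly_op (p n) B x)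
          + onorm (\<lambda>x. poly_op (p n) B x - T x)"
        by (intro always_eventually allI)
    qed
  qed
  show ?thesis
    unfolding fun_op_def
  proof (rule the_equality)
    fix S assume S: "bounded_clinear S \<and> (\<forall>p :: nat \<Rightarrow> complex poly.
        uniform_limit {- onorm B .. onorm B} (\<lambda>n s. poly (p n) (complex_of_real s)) f sequentially \<longrightarrow>
        (\<lambda>n. onorm (\<lambda>x. poly_op (p n) B x - S x)) \<longlonglongrightarrow> 0)"
    \<comment> \<open>Norm convergence along the single sequence \<open>p\<close> implies pointwise
      convergence, and pointwise limits are unique.\<close>
    have pt: "(\<lambda>n. poly_op (p n) B x) \<longlonglongrightarrow> R x"
      if R: "bounded_clinear R" and l: "(\<lambda>n. onorm (\<lambda>x. poly_op (p n) B x - R x)) \<longlonglongrightarrow> 0" for R x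
    proof (rule LIM_zero_cancel, rule Lim_null_comparison)
      show "\<forall>\<^sub>F n in sequentially. norm (poly_op (p n) B x - R x) \<le> onorm (\<lambda>x. poly_op (p n) B x - R x) * norm x"
        by (intro always_eventually allI onorm bl bounded_clinear_poly_op B R)
      show "(\<lambda>n. onorm (\<lambda>x. poly_op (p n) B x - R x) * norm x) \<longlonglongrightarrow> 0"
        using tendsto_mult_right[OF l, of "norm x"] by simp
    qed
    show "S = T"
      using LIMSEQ_unique[OF pt pt] S T lim p by blast
  qed (use T conv in blast)
qed

section \<open>The square root\<close>

text \<open>Real coefficients are recorded as invariance under conjugation. They make the
  approximating operators symmetric and let an antilinear map pass through them unchanged.\<close>

lemma Weierstrass_real_poly:
  fixes f :: "real \<Rightarrow> real"
  assumes "continuous_on {a..b} f" "e > 0"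
  shows "\<exists>p :: complex poly. map_poly cnj p = p \<and>
    (\<forall>s\<in>{a..b}. cmod (poly p (of_real s) - of_real (f s)) < e)"
proof -
  obtain g where g: "real_polynomial_function g" "\<And>s. s \<in> {a..b} \<Longrightarrow> \<bar>f s - g s\<bar> < e"
    using Stone_Weierstrass_real_polynomial_function[OF _ assms] by auto
  then obtain c n where c: "g = (\<lambda>x. \<Sum>i\<le>n. c i * x ^ i)"
    using real_polynomial_function_iff_sum by blast
  define p :: "complex poly" where "p = (\<Sum>i\<le>n. monom (of_real (c i)) i)"
  have "map_poly cnj p = p"
    by (rule poly_eqI) (simp add: p_def coeff_map_poly coeff_sum cnj_sum if_distrib cong: if_cong)
  moreover have p: "poly p (of_real s) = of_real (g s)" for s
    by (simp add: p_def c poly_sum poly_monom)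
  have "cmod (poly p (of_real s) - of_real (f s)) < e" if "s \<in> {a..b}" for s
    using g(2)[OF that] unfolding p by (simp add: abs_minus_commute flip: of_real_diff)
  ultimately show ?thesis by blast
qed

lemma Weierstrass_complex_poly:
  fixes f :: "real \<Rightarrow> complex"
  assumes f: "continuous_on {a..b} f" and e: "e > 0"
  shows "\<exists>p :: complex poly. \<forall>s\<in>{a..b}. cmod (poly p (of_real s) - f s) < e"
proof -
  have "continuous_on {a..b} (\<lambda>s. Re (f s))" "continuous_on {a..b} (\<lambda>s. Im (f s))"
    using f by (auto intro: continuous_intros)
  then obtain p q where p: "\<And>s. s \<in> {a..b} \<Longrightarrow> cmod (poly p (of_real s) - of_real (Re (f s))) < e/2"
    and q: "\<And>s. s \<in> {a..b} \<Longrightarrow> cmod (poly q (of_real s) - of_real (Im (f s))) < e/2"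
    using Weierstrass_real_poly[of a b _ "e/2"] e by (metis half_gt_zero)
  have "cmod (poly (p + smult \<i> q) (of_real s) - f s) < e" if s: "s \<in> {a..b}" for s
  proof -
    have "poly (p + smult \<i> q) (of_real s) - f s
        = (poly p (of_real s) - of_real (Re (f s))) + \<i> * (poly q (of_real s) - of_real (Im (f s)))"
      by (subst (3) complex_eq) (simp add: algebra_simps)
    then have "cmod (poly (p + smult \<i> q) (of_real s) - f s)
        \<le> cmod (poly p (of_real s) - of_real (Re (f s))) + cmod (poly q (of_real s) - of_real (Im (f s)))"
      using norm_triangle_ineq by (metis mult_1 norm_ii norm_mult)
    then show ?thesis using p[OF s] q[OF s] by linarith
  qed
  then show ?thesis by blast
qed

text \<open>Write S_n u_n = S_n (u_n - y) + S_n y; the uniform bound \<open>C\<close> removes the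
  first term. This is what makes strong limits multiplicative.\<close>

lemma strong_limit_apply:
  assumes lin: "\<And>n. bounded_clinear (S n)" and bd: "\<And>n y. norm (S n y) \<le> C * norm y"
    and S: "(\<lambda>n. S n y) \<longlonglongrightarrow> z" and y: "u \<longlonglongrightarrow> y"
  shows "(\<lambda>n. S n (u n)) \<longlonglongrightarrow> z"
proof -
  have "(\<lambda>n. S n (u n - y)) \<longlonglongrightarrow> 0"
  proof (rule Lim_null_comparison)
    show "\<forall>\<^sub>F n in sequentially. norm (S n (u n - y)) \<le> C * norm (u n - y)"
      using bd by simp
    show "(\<lambda>n. C * norm (u n - y)) \<longlonglongrightarrow> 0"
      using tendsto_mult_right_zero[OF tendsto_norm_zero[OF LIM_zero[OF y]]] .
  qed
  from tendsto_add[OF this S] show ?thesis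
    by (simp add: bounded_clinearD[OF lin])
qed

lemma poly_op_tendsto:
  assumes sa: "self_adjoint B"
    and ab: "\<And>x. a * (norm x)\<^sup>2 \<le> Re (cinner (B x) x)" "\<And>x. Re (cinner (B x) x) \<le> b * (norm x)\<^sup>2"
    and le: "a \<le> b"
    and lim: "uniform_limit {a..b} (\<lambda>n s. poly (p n) (complex_of_real s)) (\<lambda>s. poly q (of_real s)) sequentially"
  shows "(\<lambda>n. poly_op (p n) B x) \<longlonglongrightarrow> poly_op q B x"
proof (rule tendstoI)
  fix e :: real assume e: "e > 0"
  \<comment> \<open>The summand 1 covers x = 0 and makes the final inequality strict.\<close>
  define d where "d = e / (norm x + 1)"
  have d: "d > 0" using e by (simp add: d_def add_nonneg_pos)
  have "\<forall>\<^sub>F n in sequentially. \<forall>s\<in>{a..b}. dist (poly (p n) (of_real s)) (poly q (of_real s)) < d"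
    using uniform_limitD[OF lim d] .
  then show "\<forall>\<^sub>F n in sequentially. dist (poly_op (p n) B x) (poly_op q B x) < e"
  proof eventually_elim
    case (elim n)
    have "norm (poly_op (p n - q) B x) \<le> d * norm x"
      using elim by (intro norm_poly_op_le[OF sa ab le]) (force simp: dist_norm)
    also have "d * norm x < d * (norm x + 1)"
      using d by simp
    also have "\<dots> = e"
      using norm_ge_zero[of x] by (simp add: d_def add_nonneg_eq_0_iff)
    finally show ?case
      by (simp add: poly_op_diff[OF self_adjointD(1)[OF sa]] dist_norm)
  qed
qed

lemma self_adjoint_strong_limit:
  assumes sa: "self_adjoint B" and re: "\<And>n. map_poly cnj (p n) = p n"
    and lim: "\<And>x. (\<lambda>n. poly_op (p n) B x) \<longlonglongrightarrow> R x"
    and bd: "\<And>x. norm (R x) \<le> C * norm x"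
  shows "self_adjoint R"
proof -
  have B: "bounded_clinear B" using sa by (rule self_adjointD)
  note P = bounded_clinearD[OF bounded_clinear_poly_op[OF B]]
  have add: "R (x + y) = R x + R y" for x y
    by (rule LIMSEQ_unique[OF lim]) (simp only: P tendsto_add[OF lim lim])
  have scale: "R (c *\<^sub>C x) = c *\<^sub>C R x" for c x
    by (rule LIMSEQ_unique[OF lim]) (simp only: P tendsto_scaleC[OF lim])
  have "bounded_clinear R"
    unfolding bounded_clinear_def
    using bd by (auto intro!: bounded_linear_intro[of _ C] simp: add scale scaleR_scaleC mult.commute)
  moreover have "cinner (R x) y = cinner x (R y)" for x y
  proof (rule LIMSEQ_unique)
    show "(\<lambda>n. cinner (poly_op (p n) B x) y) \<longlonglongrightarrow> cinner (R x) y"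
      by (intro tendsto_cinner lim tendsto_const)
    show "(\<lambda>n. cinner (poly_op (p n) B x) y) \<longlonglongrightarrow> cinner x (R y)"
      unfolding cinner_poly_op[OF sa] re by (intro tendsto_cinner lim tendsto_const)
  qed
  ultimately show ?thesis by (simp add: self_adjoint_def)
qed

text \<open>The norm estimate turns uniform convergence of polynomials into Cauchy sequences of
  vectors. The polynomials and a common bound are exported along with the limit, since the square
  root is built by multiplying the approximants.\<close>

lemma continuous_function_of_operator:
  fixes f :: "real \<Rightarrow> real"
  assumes sa: "self_adjoint B"
    and ab: "\<And>x. a * (norm x)\<^sup>2 \<le> Re (cinner (B x) x)" "\<And>x. Re (cinner (B x) x) \<le> b * (norm x)\<^sup>2"
    and le: "a \<le> b" and f: "continuous_on {a..b} f"
  shows "\<exists>p R. (\<forall>n::nat. map_poly cnj (p n) = p n)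
    \<and> uniform_limit {a..b} (\<lambda>n s. poly (p n) (complex_of_real s)) (\<lambda>s. of_real (f s)) sequentially
    \<and> self_adjoint R \<and> (\<forall>x. (\<lambda>n. poly_op (p n) B x) \<longlonglongrightarrow> R x)
    \<and> (\<exists>C. \<forall>n x. norm (poly_op (p n) B x) \<le> C * norm x)"
proof -
  have B: "bounded_clinear B" using sa by (rule self_adjointD)
  have "\<forall>n::nat. \<exists>p :: complex poly. map_poly cnj p = p \<and>
    (\<forall>s\<in>{a..b}. cmod (poly p (of_real s) - of_real (f s)) < 1 / (real n + 1))"
    by (intro allI Weierstrass_real_poly f) simp
  then obtain p :: "nat \<Rightarrow> complex poly" where re: "\<And>n. map_poly cnj (p n) = p n"
    and p: "\<And>n s. s \<in> {a..b} \<Longrightarrow> cmod (poly (p n) (of_real s) - of_real (f s)) < 1 / (real n + 1)"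
    by metis
  have small: "(\<lambda>n. 1 / (real n + 1)) \<longlonglongrightarrow> 0"
    using LIMSEQ_inverse_real_of_nat by (simp add: inverse_eq_divide add.commute)
  have ul: "uniform_limit {a..b} (\<lambda>n s. poly (p n) (complex_of_real s)) (\<lambda>s. of_real (f s)) sequentially"
  proof (rule uniform_limitI)
    fix e :: real assume "e > 0"
    then have "\<forall>\<^sub>F n in sequentially. 1 / (real n + 1) < e"
      using order_tendstoD(2)[OF small] by blast
    then show "\<forall>\<^sub>F n in sequentially. \<forall>s\<in>{a..b}. dist (poly (p n) (of_real s)) (complex_of_real (f s)) < e"
      by eventually_elim (auto simp: dist_norm intro: less_trans[OF p])
  qed
  have diff: "norm (poly_op (p m) B x - poly_op (p n) B x) \<le> (1 / (real m + 1) + 1 / (real n + 1)) * norm x" for m n x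
  proof -
    have "norm (poly_op (p m - p n) B x) \<le> (1 / (real m + 1) + 1 / (real n + 1)) * norm x"
    proof (rule norm_poly_op_le[OF sa ab le])
      fix s assume "a \<le> s" "s \<le> b"
      then have s: "s \<in> {a..b}" by simp
      have "cmod (poly (p m - p n) (of_real s)) \<le> cmod (poly (p m) (of_real s) - of_real (f s))
          + cmod (poly (p n) (of_real s) - of_real (f s))"
        using norm_triangle_ineq4[of "poly (p m) (of_real s) - of_real (f s)" "poly (p n) (of_real s) - of_real (f s)"]
        by simp
      then show "cmod (poly (p m - p n) (of_real s)) \<le> 1 / (real m + 1) + 1 / (real n + 1)"
        using p[OF s, of m] p[OF s, of n] by linarith
    qed
    then show ?thesis by (simp add: poly_op_diff[OF B])
  qed
  have "Cauchy (\<lambda>n. poly_op (p n) B x)" for x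
  proof (rule metric_CauchyI)
    fix e :: real assume e: "e > 0"
    have "(\<lambda>n. 1 / (real n + 1) * norm x) \<longlonglongrightarrow> 0"
      using tendsto_mult_left_zero[OF small] .
    then have "\<forall>\<^sub>F n in sequentially. 1 / (real n + 1) * norm x < e / 2"
      using e by (intro order_tendstoD(2)) auto
    then obtain N where N: "\<And>n. n \<ge> N \<Longrightarrow> 1 / (real n + 1) * norm x < e / 2"
      unfolding eventually_sequentially by blast
    have "dist (poly_op (p m) B x) (poly_op (p n) B x) < e" if "m \<ge> N" "n \<ge> N" for m n
      using diff[of m x n] N[OF that(1)] N[OF that(2)] unfolding dist_norm distrib_right by linarith
    then show "\<exists>M. \<forall>m\<ge>M. \<forall>n\<ge>M. dist (poly_op (p m) B x) (poly_op (p n) B x) < e"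
      by blast
  qed
  then have "\<forall>x. \<exists>y. (\<lambda>n. poly_op (p n) B x) \<longlonglongrightarrow> y"
    using Cauchy_convergent_iff convergent_def by blast
  then obtain R where R: "\<And>x. (\<lambda>n. poly_op (p n) B x) \<longlonglongrightarrow> R x"
    by metis
  \<comment> \<open>The 2 bounds 1/(n+1) + 1/(0+1), the estimate for the distance to the operator
    with index 0.\<close>
  define C where "C = 2 + onorm (poly_op (p 0) B)"
  have bd: "norm (poly_op (p n) B x) \<le> C * norm x" for n x
  proof -
    have "norm (poly_op (p n) B x) \<le> norm (poly_op (p n) B x - poly_op (p 0) B x) + norm (poly_op (p 0) B x)"
      using norm_triangle_ineq[of "poly_op (p n) B x - poly_op (p 0) B x" "poly_op (p 0) B x"] by simp
    also have "\<dots> \<le> (1 / (real n + 1) + 1 / (real 0 + 1)) * norm x + onorm (poly_op (p 0) B) * norm x"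
      by (intro add_mono diff bounded_clinear_norm_le bounded_clinear_poly_op B)
    also have "\<dots> \<le> 2 * norm x + onorm (poly_op (p 0) B) * norm x"
      by (intro add_right_mono mult_right_mono) (simp_all add: field_simps)
    finally show ?thesis by (simp add: C_def distrib_right)
  qed
  have "norm (R x) \<le> C * norm x" for x
    by (rule LIMSEQ_le_const2[OF tendsto_norm[OF R]]) (use bd in blast)
  then have "self_adjoint R"
    using self_adjoint_strong_limit[OF sa re R] by blast
  then show ?thesis using re ul R bd by blast
qed

lemma positive_semidefinite_self_adjoint:
  assumes "bounded_clinear B" "positive_semidefinite B"
  shows "self_adjoint B" "0 \<le> Re (cinner (B x) x)"
  using assms by (auto simp: positive_semidefinite_def complex_nonneg_Reals_iff intro!: cinner_real_imp_self_adjoint)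

text \<open>The square root is constructed as \<open>R\<^sup>2\<close> with \<open>R = T\<^bsup>1/4\<^esup>\<close>, which makes it positive for free. Any other
  root \<open>S\<close> is a limit of the same polynomials in \<open>S\<^sup>2 = T\<close>.\<close>

lemma op_sqrt_exists:
  assumes T: "bounded_clinear T" "positive_semidefinite T"
  shows "\<exists>p. (\<forall>n::nat. map_poly cnj (p n) = p n) \<and> (\<forall>x. (\<lambda>n. poly_op (p n) T x) \<longlonglongrightarrow> op_sqrt T x)
    \<and> self_adjoint (op_sqrt T) \<and> (\<forall>x. op_sqrt T (op_sqrt T x) = T x)"
proof -
  note sa = positive_semidefinite_self_adjoint(1)[OF T]
  define b where "b = onorm T"
  have b0: "0 \<le> b" unfolding b_def by (rule onorm_pos_le[OF bounded_clinearD(1)[OF T(1)]])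
  have lower: "0 * (norm x)\<^sup>2 \<le> Re (cinner (T x) x)" for x
    using positive_semidefinite_self_adjoint(2)[OF T] by simp
  have upper: "Re (cinner (T x) x) \<le> b * (norm x)\<^sup>2" for x
  proof -
    have "Re (cinner (T x) x) \<le> norm (T x) * norm x"
      using complex_Re_le_cmod Cauchy_Schwarz_cinner order_trans by blast
    also have "\<dots> \<le> (b * norm x) * norm x"
      unfolding b_def by (intro mult_right_mono bounded_clinear_norm_le[OF T(1)]) simp
    finally show ?thesis by (simp add: power2_eq_square mult.assoc)
  qed
  have "continuous_on {0..b} (\<lambda>s. sqrt (sqrt s))" by (intro continuous_intros)
  from continuous_function_of_operator[OF sa lower upper b0 this]
  obtain r R C where r: "\<And>n. map_poly cnj (r n) = r n"
    and ul: "uniform_limit {0..b} (\<lambda>n s. poly (r n) (complex_of_real s)) (\<lambda>s. of_real (sqrt (sqrt s))) sequentially"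
    and R: "self_adjoint R" and lim: "\<And>x. (\<lambda>n::nat. poly_op (r n) T x) \<longlonglongrightarrow> R x"
    and C: "\<And>n x. norm (poly_op (r n) T x) \<le> C * norm x"
    by (elim exE conjE) blast
  define p where "p = (\<lambda>n. r n * r n)"
  define S where "S = (\<lambda>x. R (R x))"
  have re: "map_poly cnj (p n) = p n" for n
    by (simp add: p_def map_poly_cnj_mult r)
  have apply_r: "(\<lambda>n. poly_op (r n) T (u n)) \<longlonglongrightarrow> R y" if "u \<longlonglongrightarrow> y" for u y
    by (rule strong_limit_apply[OF bounded_clinear_poly_op[OF T(1)] C lim that])
  have limp: "(\<lambda>n. poly_op (p n) T x) \<longlonglongrightarrow> S x" for x
    unfolding p_def poly_op_mult[OF T(1)] S_def by (intro apply_r lim)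
  \<comment> \<open>Uniform convergence of products requires bounded limit functions; compactness of
    the interval provides this.\<close>
  have bdd: "bounded ((\<lambda>s. complex_of_real (f s)) ` {0..b})" if "continuous_on {0..b} f" for f
    using that by (intro compact_imp_bounded compact_continuous_image continuous_intros) auto
  have ulp: "uniform_limit {0..b} (\<lambda>n s. poly (p n) (complex_of_real s)) (\<lambda>s. of_real (sqrt s)) sequentially"
  proof -
    have "uniform_limit {0..b} (\<lambda>n s. poly (p n) (complex_of_real s))
        (\<lambda>s. of_real (sqrt (sqrt s)) * of_real (sqrt (sqrt s))) sequentially"
      unfolding p_def poly_mult by (intro uniform_lim_mult ul bdd continuous_intros)
    then show ?thesis
      by (rule uniform_limit_cong'[THEN iffD1, rotated -1]) (auto simp flip: of_real_mult)
  qed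
  \<comment> \<open>This uses that the interval starts at 0, where sqrt s * sqrt s = s.\<close>
  have ulpp: "uniform_limit {0..b} (\<lambda>n s. poly (p n * p n) (complex_of_real s)) (\<lambda>s. poly [:0,1:] (of_real s)) sequentially"
  proof -
    have "uniform_limit {0..b} (\<lambda>n s. poly (p n * p n) (complex_of_real s))
        (\<lambda>s. of_real (sqrt s) * of_real (sqrt s)) sequentially"
      unfolding poly_mult by (intro uniform_lim_mult ulp bdd continuous_intros)
    then show ?thesis
      by (rule uniform_limit_cong'[THEN iffD1, rotated -1]) (auto simp flip: of_real_mult)
  qed
  \<comment> \<open>The same operators have two limits: factor by factor they tend to
    \<open>S (S x)\<close>, while as polynomials they tend uniformly to the identity
    function.\<close>
  have SS: "S (S x) = T x" for x
  proof (rule LIMSEQ_unique)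
    show "(\<lambda>n. poly_op (p n * p n) T x) \<longlonglongrightarrow> S (S x)"
      unfolding poly_op_mult[OF T(1)] S_def p_def by (intro apply_r lim)
    show "(\<lambda>n. poly_op (p n * p n) T x) \<longlonglongrightarrow> T x"
      using poly_op_tendsto[OF sa lower upper b0 ulpp] by (simp add: poly_op_X)
  qed
  have S: "bounded_clinear S"
    unfolding S_def by (intro bounded_clinear_comp[where S=R and T=R] self_adjointD[OF R])
  have Spos: "positive_semidefinite S"
    unfolding positive_semidefinite_def S_def by (simp add: self_adjointD(2)[OF R] cinner_self)
  have uniq: "S' = S" if S': "bounded_clinear S'" "positive_semidefinite S'" "S' \<circ> S' = T" for S'
  proof
    fix x
    note sa' = positive_semidefinite_self_adjoint(1)[OF S'(1,2)]
    have lower': "0 * (norm x)\<^sup>2 \<le> Re (cinner (S' x) x)" for x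
      using positive_semidefinite_self_adjoint(2)[OF S'(1,2)] by simp
    \<comment> \<open>||S'x||^2 = <Tx,x> is at most b||x||^2, which places the numerical range of
      \<open>S'\<close> in [0, sqrt b].\<close>
    have upper': "Re (cinner (S' x) x) \<le> sqrt b * (norm x)\<^sup>2" for x
    proof -
      have "(norm (S' x))\<^sup>2 = Re (cinner (S' x) (S' x))" by (simp add: cinner_self)
      also have "\<dots> = Re (cinner (T x) x)"
        by (simp add: self_adjointD(2)[OF sa'] flip: S'(3))
      also have "\<dots> \<le> (sqrt b * norm x)\<^sup>2"
        using upper b0 by (simp add: power_mult_distrib)
      finally have "norm (S' x) \<le> sqrt b * norm x"
        using b0 by (intro power2_le_imp_le[of "norm (S' x)"]) auto
      then have "norm (S' x) * norm x \<le> sqrt b * norm x * norm x"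
        by (intro mult_right_mono) auto
      moreover have "Re (cinner (S' x) x) \<le> norm (S' x) * norm x"
        using complex_Re_le_cmod Cauchy_Schwarz_cinner order_trans by blast
      ultimately show ?thesis by (simp add: power2_eq_square mult.assoc)
    qed
    \<comment> \<open>For s in [0, sqrt b], s^2 lies in [0,b] and sqrt(s^2) = s, so
      \<open>q n\<close> tends uniformly to s there, while q_n(S') = p_n(T).\<close>
    define q where "q = (\<lambda>n. pcompose (p n) [:0,0,1:])"
    have "uniform_limit {0..sqrt b} (\<lambda>n s. poly (q n) (complex_of_real s)) (\<lambda>s. poly [:0,1:] (of_real s)) sequentially"
    proof (rule uniform_limitI)
      fix e :: real assume "e > 0"
      from uniform_limitD[OF ulp this]
      show "\<forall>\<^sub>F n in sequentially. \<forall>s\<in>{0..sqrt b}.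
          dist (poly (q n) (complex_of_real s)) (poly [:0,1:] (of_real s)) < e"
      proof eventually_elim
        case (elim n)
        have "dist (poly (q n) (complex_of_real s)) (poly [:0,1:] (of_real s)) < e" if s: "s \<in> {0..sqrt b}" for s
        proof -
          have "s\<^sup>2 \<le> (sqrt b)\<^sup>2" using s by (intro power_mono) auto
          then have "s\<^sup>2 \<in> {0..b}" using b0 by simp
          from elim[rule_format, OF this] show ?thesis
            using s by (simp add: q_def poly_pcompose power2_eq_square)
        qed
        then show ?case by blast
      qed
    qed
    from poly_op_tendsto[OF sa' lower' upper' _ this, of x] b0
    have "(\<lambda>n. poly_op (p n) (\<lambda>x. S' (S' x)) x) \<longlonglongrightarrow> S' x"
      by (simp add: q_def poly_op_pcompose_square[OF S'(1)] poly_op_X)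
    moreover have "(\<lambda>x. S' (S' x)) = T" using S'(3) by (simp add: o_def)
    ultimately show "S' x = S x"
      using LIMSEQ_unique[OF _ limp[of x]] by simp
  qed
  have "op_sqrt T = S"
    unfolding op_sqrt_def
  proof (rule the_equality)
    show "bounded_clinear S \<and> positive_semidefinite S \<and> S \<circ> S = T"
      by (intro conjI S Spos ext) (simp add: SS)
  qed (use uniq in blast)
  then show ?thesis
    using re limp SS positive_semidefinite_self_adjoint(1)[OF S Spos] by blast
qed

text \<open>Symmetry gives <AAx,x> = <Ax,Ax>, so \<open>A \<circ> A\<close> has a square root.
  Pointwise convergence is enough for commutation: \<open>A\<close> is continuous and does not alter
  real coefficients.\<close>

lemma abs_op_properties:
  assumes A: "bounded_antilinear A" and sym: "antilinear_symmetric A"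
  shows "self_adjoint (abs_op A)" "abs_op A (abs_op A x) = A (A x)" "A (abs_op A x) = abs_op A (A x)"
proof -
  have T: "bounded_clinear (A \<circ> A)"
    using A unfolding bounded_antilinear_def bounded_clinear_def
    by (auto simp: o_def intro: bounded_linear_compose)
  have "cinner (A (A x)) x = of_real ((norm (A x))\<^sup>2)" for x
    using sym unfolding antilinear_symmetric_def by (metis cinner_self)
  then have pos: "positive_semidefinite (A \<circ> A)"
    by (simp add: positive_semidefinite_def)
  obtain p where p: "\<And>n::nat. map_poly cnj (p n) = p n" "\<And>x. (\<lambda>n. poly_op (p n) (A \<circ> A) x) \<longlonglongrightarrow> abs_op A x"
    "self_adjoint (abs_op A)" "\<And>x. abs_op A (abs_op A x) = A (A x)"
    using op_sqrt_exists[OF T pos] unfolding abs_op_def by auto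
  show "self_adjoint (abs_op A)" "abs_op A (abs_op A x) = A (A x)" by fact+
  show "A (abs_op A x) = abs_op A (A x)"
  proof (rule LIMSEQ_unique)
    have "bounded_linear A" using A by (simp add: bounded_antilinear_def)
    then show "(\<lambda>n. A (poly_op (p n) (A \<circ> A) x)) \<longlonglongrightarrow> A (abs_op A x)"
      by (rule bounded_linear.tendsto) (rule p)
    show "(\<lambda>n. A (poly_op (p n) (A \<circ> A) x)) \<longlonglongrightarrow> abs_op A (A x)"
      by (subst poly_op_antilinear[OF T A]) (simp_all add: p)
  qed
qed

section \<open>Square-integrable functions\<close>

text \<open>The squared seminorm. Keeping the square avoids roots, at the price of the factors 2 in
  \<open>msq_add_le\<close> and \<open>msq_triangle\<close>.\<close>

definition msq :: "real measure \<Rightarrow> (real \<Rightarrow> complex) \<Rightarrow> real" where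
  "msq \<rho> f = (LINT s|\<rho>. (cmod (f s))\<^sup>2)"

lemma cmod_add_square_le: "(cmod (a + b))\<^sup>2 \<le> 2 * (cmod a)\<^sup>2 + 2 * (cmod b)\<^sup>2"
proof -
  have "(cmod (a + b))\<^sup>2 \<le> (cmod a + cmod b)\<^sup>2"
    by (intro power_mono norm_triangle_ineq) simp
  also have "\<dots> \<le> 2 * (cmod a)\<^sup>2 + 2 * (cmod b)\<^sup>2"
    using sum_squares_bound[of "cmod a" "cmod b"] by (simp add: power2_sum)
  finally show ?thesis .
qed

lemma L2_measurable: "f \<in> L2 \<rho> \<Longrightarrow> f \<in> borel_measurable \<rho>"
  and L2_integrable: "f \<in> L2 \<rho> \<Longrightarrow> integrable \<rho> (\<lambda>s. (cmod (f s))\<^sup>2)"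
  by (simp_all add: L2_def)

lemma L2_add:
  assumes "f \<in> L2 \<rho>" "g \<in> L2 \<rho>"
  shows "(\<lambda>s. f s + g s) \<in> L2 \<rho>"
proof -
  note [measurable] = assms[THEN L2_measurable]
  have "integrable \<rho> (\<lambda>s. 2 * (cmod (f s))\<^sup>2 + 2 * (cmod (g s))\<^sup>2)"
    using assms by (intro Bochner_Integration.integrable_add integrable_mult_right L2_integrable) auto
  then have "integrable \<rho> (\<lambda>s. (cmod (f s + g s))\<^sup>2)"
    by (rule Bochner_Integration.integrable_bound) (auto simp: cmod_add_square_le)
  then show ?thesis by (simp add: L2_def)
qed

lemma L2_scale: "f \<in> L2 \<rho> \<Longrightarrow> (\<lambda>s. c * f s) \<in> L2 \<rho>"
  by (auto simp: L2_def norm_mult power_mult_distrib)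

lemma L2_diff: "f \<in> L2 \<rho> \<Longrightarrow> g \<in> L2 \<rho> \<Longrightarrow> (\<lambda>s. f s - g s) \<in> L2 \<rho>"
  using L2_add[of f \<rho> "\<lambda>s. (-1) * g s"] L2_scale[of g \<rho> "-1"] by simp

lemma L2_mult_bounded:
  assumes f: "f \<in> L2 \<rho>" and g: "g \<in> borel_measurable \<rho>" "AE s in \<rho>. cmod (g s) \<le> C"
  shows "(\<lambda>s. g s * f s) \<in> L2 \<rho>" "msq \<rho> (\<lambda>s. g s * f s) \<le> C\<^sup>2 * msq \<rho> f"
proof -
  note [measurable] = L2_measurable[OF f] g(1)
  have le: "AE s in \<rho>. (cmod (g s * f s))\<^sup>2 \<le> C\<^sup>2 * (cmod (f s))\<^sup>2"
    using g(2)
  proof eventually_elim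
    case (elim s)
    then have "(cmod (g s))\<^sup>2 \<le> C\<^sup>2" by (intro power_mono) auto
    then show ?case by (simp add: norm_mult power_mult_distrib mult_right_mono)
  qed
  have int: "integrable \<rho> (\<lambda>s. C\<^sup>2 * (cmod (f s))\<^sup>2)"
    using L2_integrable[OF f] by simp
  from int have int': "integrable \<rho> (\<lambda>s. (cmod (g s * f s))\<^sup>2)"
    by (rule Bochner_Integration.integrable_bound) (use le in auto)
  then show "(\<lambda>s. g s * f s) \<in> L2 \<rho>" by (simp add: L2_def)
  show "msq \<rho> (\<lambda>s. g s * f s) \<le> C\<^sup>2 * msq \<rho> f"
    using integral_mono_AE[OF int' int le] by (simp add: msq_def)
qed

lemma L2_cong_AE:
  assumes "f \<in> L2 \<rho>" "g \<in> borel_measurable \<rho>" "AE s in \<rho>. f s = g s"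
  shows "g \<in> L2 \<rho>"
proof -
  have "integrable \<rho> (\<lambda>s. (cmod (g s))\<^sup>2) \<longleftrightarrow> integrable \<rho> (\<lambda>s. (cmod (f s))\<^sup>2)"
    by (rule integrable_cong_AE) (use assms L2_measurable in auto)
  then show ?thesis using assms by (simp add: L2_def)
qed

lemma msq_nonneg: "0 \<le> msq \<rho> f"
  by (simp add: msq_def)

lemma msq_cong_AE:
  assumes "f \<in> borel_measurable \<rho>" "g \<in> borel_measurable \<rho>" "AE s in \<rho>. f s = g s"
  shows "msq \<rho> f = msq \<rho> g"
  unfolding msq_def by (rule integral_cong_AE) (use assms in auto)

lemma msq_scale: "msq \<rho> (\<lambda>s. c * f s) = (cmod c)\<^sup>2 * msq \<rho> f"
  by (simp add: msq_def norm_mult power_mult_distrib)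

lemma msq_add_le:
  assumes "f \<in> L2 \<rho>" "g \<in> L2 \<rho>"
  shows "msq \<rho> (\<lambda>s. f s + g s) \<le> 2 * msq \<rho> f + 2 * msq \<rho> g"
proof -
  have "msq \<rho> (\<lambda>s. f s + g s) \<le> (LINT s|\<rho>. 2 * (cmod (f s))\<^sup>2 + 2 * (cmod (g s))\<^sup>2)"
    unfolding msq_def
    by (intro integral_mono Bochner_Integration.integrable_add integrable_mult_right L2_integrable L2_add assms cmod_add_square_le)
  also have "\<dots> = 2 * msq \<rho> f + 2 * msq \<rho> g"
    using assms[THEN L2_integrable] by (simp add: msq_def)
  finally show ?thesis .
qed

lemma msq_diff_commute: "msq \<rho> (\<lambda>s. f s - g s) = msq \<rho> (\<lambda>s. g s - f s)"
  by (simp add: msq_def norm_minus_commute)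

lemma msq_triangle:
  assumes "f \<in> L2 \<rho>" "g \<in> L2 \<rho>" "h \<in> L2 \<rho>"
  shows "msq \<rho> (\<lambda>s. f s - h s) \<le> 2 * msq \<rho> (\<lambda>s. f s - g s) + 2 * msq \<rho> (\<lambda>s. g s - h s)"
  using msq_add_le[OF L2_diff[OF assms(1,2)] L2_diff[OF assms(2,3)]] by simp

text \<open>With u = |a - b| and w = |b|, the left side is at most u(2w + u), and Young's inequality
  splits 2wu into d w^2 + u^2/d. The free weight \<open>d\<close> makes the term without a - b as
  small as desired.\<close>

lemma cmod_square_diff_le:
  assumes "d > 0"
  shows "\<bar>(cmod a)\<^sup>2 - (cmod b)\<^sup>2\<bar> \<le> d * (cmod b)\<^sup>2 + (1 + 1 / d) * (cmod (a - b))\<^sup>2"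
proof -
  define u where "u = cmod (a - b)"
  define w where "w = cmod b"
  have ab: "\<bar>cmod a - w\<bar> \<le> u" unfolding u_def w_def by (rule norm_triangle_ineq3)
  have "\<bar>(cmod a)\<^sup>2 - w\<^sup>2\<bar> = \<bar>cmod a - w\<bar> * (cmod a + w)"
    by (simp add: power2_eq_square square_diff_square_factored abs_mult w_def mult.commute)
  also have "\<dots> \<le> u * (2 * w + u)"
    using ab by (intro mult_mono) (auto simp: w_def u_def)
  also have "\<dots> \<le> d * w\<^sup>2 + (1 + 1 / d) * u\<^sup>2"
  proof -
    have "0 \<le> (d * w - u)\<^sup>2 / d" using assms by simp
    also have "\<dots> = d * w\<^sup>2 - 2 * w * u + u\<^sup>2 / d"
      using assms by (simp add: power2_diff power_mult_distrib field_simps power2_eq_square)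
    finally show ?thesis by (simp add: algebra_simps power2_eq_square)
  qed
  finally show ?thesis by (simp add: u_def w_def)
qed

lemma msq_tendsto:
  assumes f: "\<And>n. f n \<in> L2 \<rho>" "g \<in> L2 \<rho>" and lim: "(\<lambda>n. msq \<rho> (\<lambda>s. f n s - g s)) \<longlonglongrightarrow> 0"
  shows "(\<lambda>n. msq \<rho> (f n)) \<longlonglongrightarrow> msq \<rho> g"
proof -
  have bd: "\<bar>msq \<rho> (f n) - msq \<rho> g\<bar> \<le> d * msq \<rho> g + (1 + 1 / d) * msq \<rho> (\<lambda>s. f n s - g s)"
    if d: "d > 0" for d n
  proof -
    note int = L2_integrable[OF f(1)[of n]] L2_integrable[OF f(2)] L2_integrable[OF L2_diff[OF f(1)[of n] f(2)]]
    have "\<bar>msq \<rho> (f n) - msq \<rho> g\<bar> = \<bar>LINT s|\<rho>. (cmod (f n s))\<^sup>2 - (cmod (g s))\<^sup>2\<bar>"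
      unfolding msq_def using int by simp
    also have "\<dots> \<le> (LINT s|\<rho>. \<bar>(cmod (f n s))\<^sup>2 - (cmod (g s))\<^sup>2\<bar>)"
      by (rule integral_abs_bound)
    also have "\<dots> \<le> (LINT s|\<rho>. d * (cmod (g s))\<^sup>2 + (1 + 1 / d) * (cmod (f n s - g s))\<^sup>2)"
      by (intro integral_mono cmod_square_diff_le d Bochner_Integration.integrable_add integrable_mult_right integrable_abs
          Bochner_Integration.integrable_diff int)
    also have "\<dots> = d * msq \<rho> g + (1 + 1 / d) * msq \<rho> (\<lambda>s. f n s - g s)"
      unfolding msq_def using int by simp
    finally show ?thesis .
  qed
  show ?thesis
  proof (rule tendstoI)
    fix e :: real assume e: "e > 0"
    define d where "d = e / (2 * (msq \<rho> g + 1))"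
    have g0: "msq \<rho> g \<ge> 0" by (rule msq_nonneg)
    have d: "d > 0" using e g0 by (simp add: d_def)
    have "d * msq \<rho> g < d * (msq \<rho> g + 1)" using d by simp
    also have "\<dots> = e / 2" using g0 by (simp add: d_def field_simps)
    finally have small: "d * msq \<rho> g < e / 2" .
    have "(\<lambda>n. (1 + 1 / d) * msq \<rho> (\<lambda>s. f n s - g s)) \<longlonglongrightarrow> 0"
      using tendsto_mult_right_zero[OF lim] .
    then have "\<forall>\<^sub>F n in sequentially. (1 + 1 / d) * msq \<rho> (\<lambda>s. f n s - g s) < e / 2"
      using e by (intro order_tendstoD(2)) auto
    then show "\<forall>\<^sub>F n in sequentially. dist (msq \<rho> (f n)) (msq \<rho> g) < e"
    proof eventually_elim
      case (elim n)
      then show ?case using bd[OF d, of n] small unfolding dist_real_def by linarith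
    qed
  qed
qed

lemma integrable_L2_mult_cnj:
  assumes f: "f \<in> L2 \<rho>" and g: "g \<in> L2 \<rho>"
  shows "integrable \<rho> (\<lambda>s. f s * cnj (g s))"
proof -
  note [measurable] = assms[THEN L2_measurable]
  have "integrable \<rho> (\<lambda>s. (cmod (f s))\<^sup>2 + (cmod (g s))\<^sup>2)"
    using assms by (intro Bochner_Integration.integrable_add L2_integrable)
  then show ?thesis
  proof (rule Bochner_Integration.integrable_bound)
    have "cmod (f s * cnj (g s)) \<le> (cmod (f s))\<^sup>2 + (cmod (g s))\<^sup>2" for s
    proof -
      have "0 \<le> cmod (f s) * cmod (g s)" by simp
      then show ?thesis
        using sum_squares_bound[of "cmod (f s)" "cmod (g s)"]
        unfolding norm_mult complex_mod_cnj mult.assoc by linarith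
    qed
    then show "AE s in \<rho>. cmod (f s * cnj (g s)) \<le> norm ((cmod (f s))\<^sup>2 + (cmod (g s))\<^sup>2)"
      by simp
    have "cnj \<in> borel_measurable borel"
      by (intro borel_measurable_continuous_onI continuous_intros)
    then have [measurable]: "(\<lambda>s. cnj (g s)) \<in> borel_measurable \<rho>"
      using L2_measurable[OF g] by (rule measurable_compose[rotated])
    show "(\<lambda>s. f s * cnj (g s)) \<in> borel_measurable \<rho>" by measurable
  qed
qed

lemma msq_expand:
  assumes f: "f \<in> L2 \<rho>" and g: "g \<in> L2 \<rho>"
  shows "of_real (msq \<rho> (\<lambda>s. f s + c * g s)) = of_real (msq \<rho> f) + cnj c * (LINT s|\<rho>. f s * cnj (g s))
     + c * (LINT s|\<rho>. g s * cnj (f s)) + of_real ((cmod c)\<^sup>2 * msq \<rho> g)"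
proof -
  have msq: "of_real (msq \<rho> h) = (LINT s|\<rho>. h s * cnj (h s))" for h
    unfolding msq_def integral_complex_of_real[symmetric] complex_norm_square ..
  note int = integrable_L2_mult_cnj[OF f f] integrable_L2_mult_cnj[OF f g] integrable_L2_mult_cnj[OF g f]
    integrable_L2_mult_cnj[OF g g]
  have "of_real (msq \<rho> (\<lambda>s. f s + c * g s))
     = (LINT s|\<rho>. f s * cnj (f s) + (cnj c * (f s * cnj (g s)) + (c * (g s * cnj (f s)) + (c * cnj c) * (g s * cnj (g s)))))"
    unfolding msq by (simp add: algebra_simps)
  also have "\<dots> = (LINT s|\<rho>. f s * cnj (f s)) + (cnj c * (LINT s|\<rho>. f s * cnj (g s))
     + (c * (LINT s|\<rho>. g s * cnj (f s)) + (c * cnj c) * (LINT s|\<rho>. g s * cnj (g s))))"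
    using int by simp
  finally show ?thesis unfolding of_real_mult msq complex_norm_square by simp
qed

text \<open>Counterpart of \<open>cinner_polarization\<close>: an isometric linear map matches the
  two identities term by term.\<close>

lemma L2_polarization:
  assumes f: "f \<in> L2 \<rho>" and g: "g \<in> L2 \<rho>"
  shows "4 * (LINT s|\<rho>. f s * cnj (g s)) =
    of_real (msq \<rho> (\<lambda>s. f s + g s)) - of_real (msq \<rho> (\<lambda>s. f s + (-1) * g s))
     + \<i> * of_real (msq \<rho> (\<lambda>s. f s + \<i> * g s)) - \<i> * of_real (msq \<rho> (\<lambda>s. f s + (-\<i>) * g s))"
  \<comment> \<open>This instance enters as a fact, because only simplification turns
    \<open>1 * g s\<close> into the \<open>g s\<close> of the goal.\<close>
  using msq_expand[OF assms, of 1]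
  unfolding msq_expand[OF assms, of "-1"] msq_expand[OF assms, of \<i>] msq_expand[OF assms, of "-\<i>"]
  by (simp add: algebra_simps)

text \<open>The L1 subsequence theorem is applied to the sum of both squares, which dominates each
  of them; this yields one subsequence that works for both.\<close>

lemma L2_AE_subseq:
  assumes f: "\<And>n. f n \<in> L2 \<rho>" and g: "\<And>n. g n \<in> L2 \<rho>"
    and lim: "(\<lambda>n. msq \<rho> (f n)) \<longlonglongrightarrow> 0" "(\<lambda>n. msq \<rho> (g n)) \<longlonglongrightarrow> 0"
  shows "\<exists>r::nat\<Rightarrow>nat. strict_mono r \<and> (AE s in \<rho>. (\<lambda>n. f (r n) s) \<longlonglongrightarrow> 0 \<and> (\<lambda>n. g (r n) s) \<longlonglongrightarrow> 0)"
proof -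
  define u where "u = (\<lambda>n s. (cmod (f n s))\<^sup>2 + (cmod (g n s))\<^sup>2)"
  have int: "integrable \<rho> (u n)" for n
    unfolding u_def by (intro Bochner_Integration.integrable_add L2_integrable f g)
  have "(\<lambda>n. LINT s|\<rho>. norm (u n s)) = (\<lambda>n. msq \<rho> (f n) + msq \<rho> (g n))"
    unfolding u_def msq_def using L2_integrable[OF f] L2_integrable[OF g] by simp
  then have "(\<lambda>n. LINT s|\<rho>. norm (u n s)) \<longlonglongrightarrow> 0"
    using tendsto_add[OF lim] by simp
  from tendsto_L1_AE_subseq[OF int this] obtain r where r: "strict_mono r"
    "AE s in \<rho>. (\<lambda>n. u (r n) s) \<longlonglongrightarrow> 0" by blast
  from r(2) have "AE s in \<rho>. (\<lambda>n. f (r n) s) \<longlonglongrightarrow> 0 \<and> (\<lambda>n. g (r n) s) \<longlonglongrightarrow> 0"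
  proof eventually_elim
    case (elim s)
    then have sq: "(\<lambda>n. sqrt (u (r n) s)) \<longlonglongrightarrow> 0"
      using tendsto_real_sqrt by fastforce
    have "cmod (f n s) \<le> sqrt (u n s)" "cmod (g n s) \<le> sqrt (u n s)" for n
      unfolding u_def by (auto intro!: real_le_rsqrt)
    then show ?case
      by (intro conjI Lim_null_comparison[OF _ sq]) auto
  qed
  with r(1) show ?thesis by blast
qed

text \<open>Finiteness of the measure converts fast L2 decay of the increments into summable L1
  norms, so a subsequence converges almost everywhere.\<close>

theorem Riesz_Fischer_L2:
  assumes fin: "finite_measure \<rho>" and f: "\<And>n::nat. f n \<in> L2 \<rho>"
    and cauchy: "\<And>e. e > 0 \<Longrightarrow> \<exists>N. \<forall>m\<ge>N. \<forall>n\<ge>N. msq \<rho> (\<lambda>s. f m s - f n s) < e"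
  shows "\<exists>g \<in> L2 \<rho>. (\<lambda>n. msq \<rho> (\<lambda>s. f n s - g s)) \<longlonglongrightarrow> 0"
proof -
  interpret finite_measure \<rho> by fact
  note [measurable] = f[THEN L2_measurable]
  \<comment> \<open>The rate 4^-k is chosen to beat the weight 2^k that appears in the L1 estimate
    of the increments.\<close>
  have "\<exists>N. \<forall>k. (\<forall>m\<ge>N k. \<forall>n\<ge>N k. msq \<rho> (\<lambda>s. f m s - f n s) < (1/4)^k) \<and> N k < N (Suc k)"
  proof (rule dependent_nat_choice)
    show "\<exists>N. \<forall>m\<ge>N. \<forall>n\<ge>N. msq \<rho> (\<lambda>s. f m s - f n s) < (1/4)^0"
      by (rule cauchy) simp
    fix N :: nat and k :: nat
    obtain M where M: "\<forall>m\<ge>M. \<forall>n\<ge>M. msq \<rho> (\<lambda>s. f m s - f n s) < (1/4)^(Suc k)"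
      using cauchy[of "(1/4)^(Suc k)"] by auto
    then show "\<exists>M. (\<forall>m\<ge>M. \<forall>n\<ge>M. msq \<rho> (\<lambda>s. f m s - f n s) < (1/4)^(Suc k)) \<and> N < M"
      by (intro exI[of _ "max M (Suc N)"]) auto
  qed
  then obtain r :: "nat \<Rightarrow> nat" where r: "\<And>k m n. r k \<le> m \<Longrightarrow> r k \<le> n \<Longrightarrow> msq \<rho> (\<lambda>s. f m s - f n s) < (1/4)^k"
    and mono: "\<And>k. r k < r (Suc k)"
    by blast
  have r_mono: "r j \<le> r k" if "j \<le> k" for j k
    using lift_Suc_mono_le[of r, OF less_imp_le[OF mono] that] .
  define d where "d = (\<lambda>k s. f (r (Suc k)) s - f (r k) s)"
  have d: "d k \<in> L2 \<rho>" for k unfolding d_def by (intro L2_diff f)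
  note [measurable] = d[THEN L2_measurable]
  have dint: "(\<integral>\<^sup>+s. ennreal (cmod (d k s)) \<partial>\<rho>) \<le> ennreal ((1/2)^k * (1 + measure \<rho> (space \<rho>)))" for k
  proof -
    \<comment> \<open>This is u at most u^2 + 1 for u = 2^k |d|, divided by 2^k. Both terms then
      integrate to multiples of 2^-k.\<close>
    have "cmod (d k s) \<le> 2^k * (cmod (d k s))\<^sup>2 + (1/2)^k" for s
    proof -
      define u where "u = 2^k * cmod (d k s)"
      have "2 * u \<le> u\<^sup>2 + 1\<^sup>2" using sum_squares_bound[of u 1] by simp
      moreover have "u \<ge> 0" by (simp add: u_def)
      ultimately have "u \<le> u\<^sup>2 + 1" by simp
      then have "u / 2^k \<le> (u\<^sup>2 + 1) / 2^k" by (rule divide_right_mono) simp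
      then show ?thesis by (simp add: u_def power2_eq_square field_simps)
    qed
    then have "(\<integral>\<^sup>+s. ennreal (cmod (d k s)) \<partial>\<rho>) \<le> (\<integral>\<^sup>+s. ennreal (2^k * (cmod (d k s))\<^sup>2 + (1/2)^k) \<partial>\<rho>)"
      by (intro nn_integral_mono ennreal_leI)
    also have "\<dots> = ennreal (LINT s|\<rho>. 2^k * (cmod (d k s))\<^sup>2 + (1/2)^k)"
      by (intro nn_integral_eq_integral Bochner_Integration.integrable_add integrable_mult_right L2_integrable d) auto
    also have "(LINT s|\<rho>. 2^k * (cmod (d k s))\<^sup>2 + (1/2)^k) = 2^k * msq \<rho> (d k) + (1/2)^k * measure \<rho> (space \<rho>)"
      using L2_integrable[OF d[of k]] by (simp add: msq_def)
    also have "ennreal (2^k * msq \<rho> (d k) + (1/2)^k * measure \<rho> (space \<rho>))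
        \<le> ennreal (2^k * (1/4)^k + (1/2)^k * measure \<rho> (space \<rho>))"
      using r[of k "r (Suc k)" "r k"] mono[of k] unfolding d_def
      by (intro ennreal_leI add_right_mono mult_left_mono) auto
    also have "2^k * (1/4)^k = (1/2::real)^k" by (simp flip: power_mult_distrib)
    finally show ?thesis by (simp add: algebra_simps)
  qed
  have "(\<integral>\<^sup>+s. (\<Sum>k. ennreal (cmod (d k s))) \<partial>\<rho>) = (\<Sum>k. \<integral>\<^sup>+s. ennreal (cmod (d k s)) \<partial>\<rho>)"
    by (rule nn_integral_suminf) measurable
  also have "\<dots> \<le> (\<Sum>k. ennreal ((1/2)^k * (1 + measure \<rho> (space \<rho>))))"
    by (intro suminf_le dint) auto
  also have "\<dots> = ennreal (\<Sum>k. (1/2)^k * (1 + measure \<rho> (space \<rho>)))"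
    by (intro suminf_ennreal2 summable_mult2 summable_geometric) auto
  finally have "(\<integral>\<^sup>+s. (\<Sum>k. ennreal (cmod (d k s))) \<partial>\<rho>) \<noteq> \<infinity>"
    by (auto simp: top_unique)
  then have "AE s in \<rho>. (\<Sum>k. ennreal (cmod (d k s))) \<noteq> \<infinity>"
    by (intro nn_integral_PInf_AE) measurable
  then have conv: "AE s in \<rho>. convergent (\<lambda>k. f (r k) s)"
  proof eventually_elim
    case (elim s)
    then have "summable (\<lambda>k. cmod (d k s))"
      by (intro summable_suminf_not_top) auto
    then have "summable (\<lambda>k. d k s)" by (rule summable_norm_cancel)
    then have "convergent (\<lambda>n. \<Sum>k<n. d k s)" by (rule summable_iff_convergent[THEN iffD1])
    then have "convergent (\<lambda>n. f (r n) s - f (r 0) s)"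
      unfolding d_def sum_lessThan_telescope[of "\<lambda>k. f (r k) s"] .
    then show ?case by (simp add: convergent_diff_const_right_iff)
  qed
  \<comment> \<open>\<open>lim\<close> also returns a value at points of divergence;
    \<open>g\<close> remains measurable and these points form a null set.\<close>
  define g where "g = (\<lambda>s. lim (\<lambda>k. f (r k) s))"
  have [measurable]: "g \<in> borel_measurable \<rho>" unfolding g_def by measurable
  have lim: "AE s in \<rho>. (\<lambda>k. f (r k) s) \<longlonglongrightarrow> g s"
    using conv unfolding g_def by (simp add: convergent_LIMSEQ_iff)
  \<comment> \<open>Fatou's lemma with \<open>n\<close> fixed and \<open>r j\<close> tending to
    infinity gives integrability and the bound together.\<close>
  have bd: "integrable \<rho> (\<lambda>s. (cmod (f n s - g s))\<^sup>2) \<and> msq \<rho> (\<lambda>s. f n s - g s) \<le> (1/4)^k" if n: "n \<ge> r k" for n k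
  proof -
    have "(\<integral>\<^sup>+s. ennreal ((cmod (f n s - g s))\<^sup>2) \<partial>\<rho>)
        = (\<integral>\<^sup>+s. liminf (\<lambda>j. ennreal ((cmod (f n s - f (r j) s))\<^sup>2)) \<partial>\<rho>)"
    proof (rule nn_integral_cong_AE)
      show "AE s in \<rho>. ennreal ((cmod (f n s - g s))\<^sup>2) = liminf (\<lambda>j. ennreal ((cmod (f n s - f (r j) s))\<^sup>2))"
        using lim
      proof eventually_elim
        case (elim s)
        have "(\<lambda>j. ennreal ((cmod (f n s - f (r j) s))\<^sup>2)) \<longlonglongrightarrow> ennreal ((cmod (f n s - g s))\<^sup>2)"
          by (intro tendsto_ennrealI tendsto_intros elim)
        from lim_imp_Liminf[OF trivial_limit_sequentially this] show ?case by (rule sym)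
      qed
    qed
    also have "\<dots> \<le> liminf (\<lambda>j. \<integral>\<^sup>+s. ennreal ((cmod (f n s - f (r j) s))\<^sup>2) \<partial>\<rho>)"
      by (rule nn_integral_liminf) measurable
    also have "\<dots> \<le> ennreal ((1/4)^k)"
    proof (rule Liminf_le)
      have "(\<integral>\<^sup>+s. ennreal ((cmod (f n s - f (r j) s))\<^sup>2) \<partial>\<rho>) \<le> ennreal ((1/4)^k)" if "j \<ge> k" for j
      proof -
        have "(\<integral>\<^sup>+s. ennreal ((cmod (f n s - f (r j) s))\<^sup>2) \<partial>\<rho>) = ennreal (msq \<rho> (\<lambda>s. f n s - f (r j) s))"
          unfolding msq_def by (intro nn_integral_eq_integral L2_integrable L2_diff f) auto
        then show ?thesis
          using r[OF n r_mono[OF that]] by (simp add: ennreal_leI)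
      qed
      then show "\<forall>\<^sub>F j in sequentially. (\<integral>\<^sup>+s. ennreal ((cmod (f n s - f (r j) s))\<^sup>2) \<partial>\<rho>) \<le> ennreal ((1/4)^k)"
        unfolding eventually_sequentially by blast
    qed simp
    finally have le: "(\<integral>\<^sup>+s. ennreal ((cmod (f n s - g s))\<^sup>2) \<partial>\<rho>) \<le> ennreal ((1/4)^k)" .
    then have int: "integrable \<rho> (\<lambda>s. (cmod (f n s - g s))\<^sup>2)"
      by (intro integrableI_bounded) (auto simp: top_unique intro: le_less_trans)
    moreover have "ennreal (msq \<rho> (\<lambda>s. f n s - g s)) = (\<integral>\<^sup>+s. ennreal ((cmod (f n s - g s))\<^sup>2) \<partial>\<rho>)"
      unfolding msq_def using int by (intro nn_integral_eq_integral[symmetric]) auto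
    then have "ennreal (msq \<rho> (\<lambda>s. f n s - g s)) \<le> ennreal ((1/4)^k)" using le by simp
    ultimately show ?thesis by (simp add: ennreal_le_iff)
  qed
  have "(\<lambda>s. f (r 0) s - g s) \<in> L2 \<rho>" using bd[of 0 "r 0"] by (simp add: L2_def)
  from L2_diff[OF f[of "r 0"] this] have "g \<in> L2 \<rho>" by simp
  moreover have "(\<lambda>n. msq \<rho> (\<lambda>s. f n s - g s)) \<longlonglongrightarrow> 0"
  proof (rule tendstoI)
    fix e :: real assume "e > 0"
    then obtain k where k: "(1/4)^k < e"
      using real_arch_pow_inv[of e "1/4"] by auto
    show "\<forall>\<^sub>F n in sequentially. dist (msq \<rho> (\<lambda>s. f n s - g s)) 0 < e"
      unfolding eventually_sequentially
      by (intro exI[of _ "r k"] allI impI) (use bd k msq_nonneg[of \<rho>] in \<open>force simp: dist_real_def\<close>)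
  qed
  ultimately show ?thesis by blast
qed

section \<open>Density of the polynomials\<close>

definition poly_fun :: "complex poly \<Rightarrow> real \<Rightarrow> complex" where
  "poly_fun p = (\<lambda>s. poly p (complex_of_real s))"

lemma poly_fun_add: "poly_fun (p + q) = (\<lambda>s. poly_fun p s + poly_fun q s)"
  and poly_fun_diff: "poly_fun (p - q) = (\<lambda>s. poly_fun p s - poly_fun q s)"
  and poly_fun_smult: "poly_fun (smult c p) = (\<lambda>s. c * poly_fun p s)"
  by (simp_all add: poly_fun_def)

text \<open>Bounded support makes continuous functions, in particular polynomials, bounded almost
  everywhere and so square-integrable.\<close>

locale compactly_supported_measure = finite_measure \<rho> for \<rho> :: "real measure" +
  fixes R :: real
  assumes sets_borel: "sets \<rho> = sets borel" and support: "AE s in \<rho>. \<bar>s\<bar> \<le> R"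
begin

lemma borel_imp_measurable: "f \<in> borel_measurable borel \<Longrightarrow> f \<in> borel_measurable \<rho>"
  using measurable_cong_sets[OF sets_borel refl] by blast

lemma L2_bounded:
  assumes "f \<in> borel_measurable \<rho>" "AE s in \<rho>. cmod (f s) \<le> C"
  shows "f \<in> L2 \<rho>" "msq \<rho> f \<le> C\<^sup>2 * measure \<rho> (space \<rho>)"
proof -
  have 1: "(\<lambda>s. 1) \<in> L2 \<rho>" by (simp add: L2_def)
  show "f \<in> L2 \<rho>" "msq \<rho> f \<le> C\<^sup>2 * measure \<rho> (space \<rho>)"
    using L2_mult_bounded[OF 1 assms] by (simp_all add: msq_def[of _ "\<lambda>_. 1"])
qed

lemma continuous_AE_bounded:
  assumes f: "continuous_on UNIV (f :: real \<Rightarrow> complex)"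
  shows "\<exists>C. AE s in \<rho>. cmod (f s) \<le> C"
proof -
  have "bounded (f ` {-R..R})"
    using f by (intro compact_imp_bounded compact_continuous_image) (auto intro: continuous_on_subset)
  then obtain C where C: "\<And>s. s \<in> {-R..R} \<Longrightarrow> cmod (f s) \<le> C"
    unfolding bounded_iff by blast
  have "AE s in \<rho>. cmod (f s) \<le> C"
    using support by eventually_elim (auto intro!: C)
  then show ?thesis ..
qed

lemma continuous_measurable: "continuous_on UNIV (f :: real \<Rightarrow> complex) \<Longrightarrow> f \<in> borel_measurable \<rho>"
  by (intro borel_imp_measurable borel_measurable_continuous_onI)

lemma L2_continuous: "continuous_on UNIV f \<Longrightarrow> f \<in> L2 \<rho>"
  using continuous_AE_bounded L2_bounded continuous_measurable by blast

lemma L2_mult_continuous: "continuous_on UNIV g \<Longrightarrow> f \<in> L2 \<rho> \<Longrightarrow> (\<lambda>s. g s * f s) \<in> L2 \<rho>"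
  using continuous_AE_bounded L2_mult_bounded continuous_measurable by blast

lemma L2_poly_fun: "poly_fun p \<in> L2 \<rho>"
  unfolding poly_fun_def by (intro L2_continuous continuous_intros)

text \<open>Membership in the L2 closure of the polynomials. This closed subspace is shown to
  contain continuous functions, then indicators, simple functions and finally everything.\<close>

definition poly_approx :: "(real \<Rightarrow> complex) \<Rightarrow> bool" where
  "poly_approx f \<longleftrightarrow> f \<in> L2 \<rho> \<and> (\<forall>e>0. \<exists>p. msq \<rho> (\<lambda>s. f s - poly_fun p s) < e)"

lemma poly_approx_closed:
  assumes f: "f \<in> L2 \<rho>" and approx: "\<And>e. e > 0 \<Longrightarrow> \<exists>g. poly_approx g \<and> msq \<rho> (\<lambda>s. f s - g s) < e"
  shows "poly_approx f"
  unfolding poly_approx_def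
proof (intro conjI f allI impI)
  fix e :: real assume e: "e > 0"
  then obtain g where g: "poly_approx g" "msq \<rho> (\<lambda>s. f s - g s) < e/4"
    using approx[of "e/4"] by auto
  then obtain p where p: "msq \<rho> (\<lambda>s. g s - poly_fun p s) < e/4"
    using e unfolding poly_approx_def by (meson divide_pos_pos zero_less_numeral)
  have "msq \<rho> (\<lambda>s. f s - poly_fun p s) \<le> 2 * msq \<rho> (\<lambda>s. f s - g s) + 2 * msq \<rho> (\<lambda>s. g s - poly_fun p s)"
    using f g(1) by (intro msq_triangle L2_poly_fun) (auto simp: poly_approx_def)
  with g(2) p show "\<exists>p. msq \<rho> (\<lambda>s. f s - poly_fun p s) < e" by (intro exI[of _ p]) simp
qed

lemma poly_approx_scale:
  assumes "poly_approx f" shows "poly_approx (\<lambda>s. c * f s)"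
proof (cases "c = 0")
  case True
  have "poly_approx (poly_fun 0)"
    unfolding poly_approx_def by (intro conjI L2_poly_fun allI impI exI[of _ 0]) (simp add: msq_def)
  then show ?thesis using True by (simp add: poly_fun_def)
next
  case False
  show ?thesis
    unfolding poly_approx_def
  proof (intro conjI allI impI)
    fix e :: real assume "e > 0"
    then have "e / (cmod c)\<^sup>2 > 0" using False by simp
    then obtain p where p: "msq \<rho> (\<lambda>s. f s - poly_fun p s) < e / (cmod c)\<^sup>2"
      using assms unfolding poly_approx_def by blast
    have "msq \<rho> (\<lambda>s. c * f s - poly_fun (smult c p) s) = (cmod c)\<^sup>2 * msq \<rho> (\<lambda>s. f s - poly_fun p s)"
      by (simp add: poly_fun_smult msq_scale flip: right_diff_distrib)
    also have "\<dots> < e" using p False by (simp add: field_simps)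
    finally show "\<exists>p. msq \<rho> (\<lambda>s. c * f s - poly_fun p s) < e" by blast
  qed (use assms in \<open>auto simp: poly_approx_def L2_scale\<close>)
qed

lemma poly_approx_add:
  assumes "poly_approx f" "poly_approx g" shows "poly_approx (\<lambda>s. f s + g s)"
  unfolding poly_approx_def
proof (intro conjI allI impI)
  fix e :: real assume "e > 0"
  then have "e/4 > 0" by simp
  then obtain p q where pq: "msq \<rho> (\<lambda>s. f s - poly_fun p s) < e/4" "msq \<rho> (\<lambda>s. g s - poly_fun q s) < e/4"
    using assms unfolding poly_approx_def by meson
  have "msq \<rho> (\<lambda>s. f s + g s - poly_fun (p + q) s) = msq \<rho> (\<lambda>s. (f s - poly_fun p s) + (g s - poly_fun q s))"
    by (simp add: poly_fun_add algebra_simps)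
  also have "\<dots> \<le> 2 * msq \<rho> (\<lambda>s. f s - poly_fun p s) + 2 * msq \<rho> (\<lambda>s. g s - poly_fun q s)"
    using assms by (intro msq_add_le L2_diff L2_poly_fun) (auto simp: poly_approx_def)
  finally show "\<exists>p. msq \<rho> (\<lambda>s. f s + g s - poly_fun p s) < e" using pq by (intro exI[of _ "p + q"]) simp
qed (use assms in \<open>auto simp: poly_approx_def L2_add\<close>)

lemma poly_approx_continuous:
  assumes f: "continuous_on UNIV f"
  shows "poly_approx f"
  unfolding poly_approx_def
proof (intro conjI allI impI)
  show "f \<in> L2 \<rho>" using f by (rule L2_continuous)
  fix e :: real assume e: "e > 0"
  define m where "m = measure \<rho> (space \<rho>)"
  \<comment> \<open>\<open>m + 1\<close> instead of \<open>m\<close> covers the zero measure and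
    makes d^2 m < e strict.\<close>
  define d where "d = sqrt (e / (m + 1))"
  have m: "m \<ge> 0" by (simp add: m_def)
  have d: "d > 0" using e m by (simp add: d_def)
  obtain p where p: "\<And>s. s \<in> {-R..R} \<Longrightarrow> cmod (poly p (of_real s) - f s) < d"
    using Weierstrass_complex_poly[of "-R" R f, OF _ d] f continuous_on_subset by blast
  have "msq \<rho> (\<lambda>s. f s - poly_fun p s) \<le> d\<^sup>2 * m"
    unfolding m_def
  proof (rule L2_bounded)
    show "(\<lambda>s. f s - poly_fun p s) \<in> borel_measurable \<rho>"
      by (intro L2_measurable L2_diff L2_poly_fun L2_continuous f)
    show "AE s in \<rho>. cmod (f s - poly_fun p s) \<le> d"
      using support
    proof eventually_elim
      case (elim s)
      then have "s \<in> {-R..R}" by auto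
      from p[OF this] show ?case by (simp add: poly_fun_def norm_minus_commute)
    qed
  qed
  also have "\<dots> < e" using e m by (simp add: d_def field_simps)
  finally show "\<exists>p. msq \<rho> (\<lambda>s. f s - poly_fun p s) < e" by blast
qed

text \<open>Regularity squeezes \<open>A\<close> between a compact K and an open V with V - K of
  small measure. A Urysohn function for K and V differs from the indicator only on V - K, by at most
  1.\<close>

lemma poly_approx_indicator:
  assumes A: "A \<in> sets borel"
  shows "poly_approx (indicator A)"
proof (rule poly_approx_closed)
  have meas: "(indicator A :: real \<Rightarrow> complex) \<in> borel_measurable \<rho>"
    using A sets_borel by simp
  show "indicator A \<in> L2 \<rho>"
    by (rule L2_bounded[of _ 1]) (use meas in \<open>auto simp: indicator_def\<close>)
  fix e :: real assume e: "e > 0"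
  have fin: "emeasure \<rho> (space \<rho>) \<noteq> \<infinity>" "emeasure \<rho> A \<noteq> \<infinity>" by (auto simp: emeasure_eq_measure)
  obtain K where K: "K \<subseteq> A" "compact K" "emeasure \<rho> A < emeasure \<rho> K + ennreal (e/2)"
    using SUP_approx_ennreal[OF _ _ inner_regular[OF sets_borel fin(1) A] fin(2), of "e/2"] e
      exI[of "\<lambda>K. K \<subseteq> A \<and> compact K" "{}"] by auto
  obtain V where V: "A \<subseteq> V" "open V" "emeasure \<rho> V < emeasure \<rho> A + ennreal (e/2)"
    using INF_approx_ennreal[OF _ outer_regular[OF sets_borel fin(1) A] fin(2), of "e/2"] e by auto
  have sets: "K \<in> sets \<rho>" "V \<in> sets \<rho>" "A \<in> sets \<rho>"
    using K V A sets_borel by (auto simp: borel_compact)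
  have KV: "measure \<rho> (V - K) < e"
  proof -
    have "ennreal (measure \<rho> A) < ennreal (measure \<rho> K + e/2)" "ennreal (measure \<rho> V) < ennreal (measure \<rho> A + e/2)"
      using K(3) V(3) e by (simp_all add: emeasure_eq_measure ennreal_plus)
    then have "measure \<rho> V < measure \<rho> K + e" by (simp add: ennreal_less_iff)
    then show ?thesis using K V sets by (subst finite_measure_Diff) auto
  qed
  have "closed K" "closed (- V)" "K \<inter> - V = {}"
    using K V by (auto simp: compact_imp_closed)
  then obtain g :: "real \<Rightarrow> real" where g: "continuous_on UNIV g" "\<And>x. g x \<in> closed_segment 1 0"
    "\<And>x. x \<in> K \<Longrightarrow> g x = 1" "\<And>x. x \<in> - V \<Longrightarrow> g x = 0"
    using Urysohn[of K "-V" 1 0] by blast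
  define h where "h = (\<lambda>x. complex_of_real (g x))"
  have h: "continuous_on UNIV h" unfolding h_def using g(1) by (intro continuous_intros)
  have g01: "0 \<le> g x" "g x \<le> 1" for x using g(2)[of x] by (auto simp: closed_segment_eq_real_ivl)
  have le: "(cmod (indicator A x - h x))\<^sup>2 \<le> indicator (V - K) x" for x
  proof (cases "x \<in> V - K")
    case True
    have "indicator A x - h x = complex_of_real (indicator A x - g x)" by (simp add: h_def indicator_def)
    moreover have "\<bar>indicator A x - g x\<bar> \<le> 1" using g01[of x] by (auto simp: indicator_def)
    ultimately show ?thesis using True by (simp add: abs_square_le_1 del: of_real_diff)
  next
    case False
    then have "indicator A x = h x" using K V g(3,4)[of x] by (auto simp: h_def indicator_def)
    then show ?thesis by simp
  qed
  have "msq \<rho> (\<lambda>x. indicator A x - h x) \<le> (LINT x|\<rho>. indicator (V - K) x)"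
    unfolding msq_def
    using sets fin(1)
    by (intro integral_mono le L2_integrable L2_diff[OF \<open>indicator A \<in> L2 \<rho>\<close> L2_continuous[OF h]])
      (auto simp: less_top emeasure_eq_measure)
  also have "\<dots> = measure \<rho> (V - K)" using sets by simp
  finally have "msq \<rho> (\<lambda>x. indicator A x - h x) < e" using KV by simp
  then show "\<exists>g. poly_approx g \<and> msq \<rho> (\<lambda>s. indicator A s - g s) < e"
    using poly_approx_continuous[OF h] by blast
qed

theorem poly_approx_L2:
  assumes f: "f \<in> L2 \<rho>"
  shows "poly_approx f"
proof (rule poly_approx_closed[OF f])
  note [measurable] = L2_measurable[OF f]
  obtain F where F: "\<And>i. simple_function \<rho> (F i)" "\<And>s. s \<in> space \<rho> \<Longrightarrow> (\<lambda>i. F i s) \<longlonglongrightarrow> f s"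
    "\<And>i s. s \<in> space \<rho> \<Longrightarrow> dist (F i s) 0 \<le> 2 * dist (f s) 0"
    using borel_measurable_implies_sequence_metric[OF L2_measurable[OF f], of 0] by blast
  note [measurable] = borel_measurable_simple_function[OF F(1)]
  have approx: "poly_approx (F i)" for i
  proof -
    have sp: "space \<rho> = UNIV" using sets_eq_imp_space_eq[OF sets_borel] by simp
    have fin: "finite (range (F i))" using F(1)[of i] sp by (simp add: simple_function_def)
    have "poly_approx (\<lambda>s. \<Sum>y\<in>Y. y * indicator (F i -` {y}) s)" if "finite Y" for Y
      using that
    proof (induction Y)
      case empty
      then show ?case using poly_approx_continuous[of "\<lambda>_. 0"] by simp
    next
      case (insert y Y)
      have "F i -` {y} \<inter> space \<rho> \<in> sets \<rho>" using F(1)[of i] by (rule simple_functionD)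
      then have "F i -` {y} \<in> sets borel" using sp sets_borel by simp
      then show ?case
        unfolding sum.insert[OF insert(1,2)]
        by (intro poly_approx_add poly_approx_scale poly_approx_indicator insert)
    qed
    from this[OF fin] have "poly_approx (\<lambda>s. \<Sum>y\<in>range (F i). y * indicator (F i -` {y}) s)" .
    moreover have "(\<Sum>y\<in>range (F i). y * indicator (F i -` {y}) s) = F i s" for s
    proof -
      have "(\<Sum>y\<in>range (F i). y * indicator (F i -` {y}) s) = (\<Sum>y\<in>range (F i). if F i s = y then y else 0)"
        by (intro sum.cong) (auto simp: indicator_def)
      then show ?thesis using fin by simp
    qed
    ultimately show ?thesis by simp
  qed
  have "(\<lambda>i. LINT s|\<rho>. (cmod (f s - F i s))\<^sup>2) \<longlonglongrightarrow> (LINT s|\<rho>. 0)"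
  proof (rule integral_dominated_convergence)
    \<comment> \<open>9 = 3^2: the simple functions satisfy |F| <= 2|f|, so |f - F| <= 3|f|.\<close>
    show "integrable \<rho> (\<lambda>s. 9 * (cmod (f s))\<^sup>2)" using L2_integrable[OF f] by simp
    show "AE s in \<rho>. (\<lambda>i. (cmod (f s - F i s))\<^sup>2) \<longlonglongrightarrow> 0"
    proof (rule AE_I2)
      fix s assume "s \<in> space \<rho>"
      then have "(\<lambda>i. (cmod (f s - F i s))\<^sup>2) \<longlonglongrightarrow> (cmod (f s - f s))\<^sup>2"
        by (intro tendsto_intros F)
      then show "(\<lambda>i. (cmod (f s - F i s))\<^sup>2) \<longlonglongrightarrow> 0" by simp
    qed
    show "AE s in \<rho>. norm ((cmod (f s - F i s))\<^sup>2) \<le> 9 * (cmod (f s))\<^sup>2" for i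
    proof (rule AE_I2)
      fix s assume "s \<in> space \<rho>"
      then have "cmod (f s - F i s) \<le> 3 * cmod (f s)"
        using F(3)[of s i] norm_triangle_ineq4[of "f s" "F i s"] by simp
      then have "(cmod (f s - F i s))\<^sup>2 \<le> (3 * cmod (f s))\<^sup>2" by (intro power_mono) auto
      then show "norm ((cmod (f s - F i s))\<^sup>2) \<le> 9 * (cmod (f s))\<^sup>2" by (simp add: power_mult_distrib)
    qed
  qed measurable
  then have "(\<lambda>i. msq \<rho> (\<lambda>s. f s - F i s)) \<longlonglongrightarrow> 0" by (simp add: msq_def)
  then show "\<exists>g. poly_approx g \<and> msq \<rho> (\<lambda>s. f s - g s) < e" if "e > 0" for e
    using eventually_happens[OF order_tendstoD(2)[OF _ that]] approx trivial_limit_sequentially by blast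
qed

end

section \<open>The spectral representation\<close>

text \<open>Condenses cyclicity and the spectral measure into density and an isometry on
  polynomials; the functional calculus is not mentioned from here on.\<close>

locale cyclic_model = compactly_supported_measure \<rho> R for \<rho> R +
  fixes B :: "'a::complex_hilbert \<Rightarrow> 'a" and v :: 'a
  assumes sa: "self_adjoint B"
    and dense: "closure (range (\<lambda>p. poly_op p B v)) = UNIV"
    and isometry: "msq \<rho> (poly_fun p) = (norm (poly_op p B v))\<^sup>2"
begin

lemma clinear: "bounded_clinear B"
  using sa by (rule self_adjointD)

lemma isometry_diff: "(norm (poly_op p B v - poly_op q B v))\<^sup>2 = msq \<rho> (\<lambda>s. poly_fun p s - poly_fun q s)"
  using isometry[of "p - q"] by (simp add: poly_op_diff[OF clinear] poly_fun_diff)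

text \<open>Extension by continuity as a relation: one sequence of polynomials approximates both
  \<open>f\<close> and \<open>x\<close>. Linearity and the norm identity can thus be proved before
  single-valuedness, which follows from them.\<close>

definition rep :: "(real \<Rightarrow> complex) \<Rightarrow> 'a \<Rightarrow> bool" where
  "rep f x \<longleftrightarrow> (\<exists>p. (\<lambda>n. msq \<rho> (\<lambda>s. f s - poly_fun (p n) s)) \<longlonglongrightarrow> 0 \<and> (\<lambda>n. poly_op (p n) B v) \<longlonglongrightarrow> x)"

lemma repI:
  "(\<lambda>n. msq \<rho> (\<lambda>s. f s - poly_fun (p n) s)) \<longlonglongrightarrow> 0 \<Longrightarrow> (\<lambda>n. poly_op (p n) B v) \<longlonglongrightarrow> x \<Longrightarrow> rep f x"
  unfolding rep_def by blast

lemma rep_exists: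
  assumes f: "f \<in> L2 \<rho>"
  shows "\<exists>x. rep f x"
proof -
  have "\<forall>n. \<exists>p. msq \<rho> (\<lambda>s. f s - poly_fun p s) < inverse (real (Suc n))"
    using poly_approx_L2[OF f] unfolding poly_approx_def by simp
  then obtain p where p: "\<And>n. msq \<rho> (\<lambda>s. f s - poly_fun (p n) s) < inverse (real (Suc n))"
    by metis
  have lim: "(\<lambda>n. msq \<rho> (\<lambda>s. f s - poly_fun (p n) s)) \<longlonglongrightarrow> 0"
    by (rule tendsto_sandwich[OF _ _ tendsto_const LIMSEQ_inverse_real_of_nat])
      (use p msq_nonneg in \<open>auto intro!: always_eventually less_imp_le simp del: of_nat_Suc\<close>)
  have "Cauchy (\<lambda>n. poly_op (p n) B v)"
  proof (rule metric_CauchyI)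
    fix e :: real assume e: "e > 0"
    \<comment> \<open>Two errors below e^2/4, each doubled by \<open>msq_triangle\<close>, add up to
      less than e^2.\<close>
    then have "\<forall>\<^sub>F n in sequentially. msq \<rho> (\<lambda>s. f s - poly_fun (p n) s) < e\<^sup>2 / 4"
      by (intro order_tendstoD(2)[OF lim]) simp
    then obtain N where N: "\<And>n. n \<ge> N \<Longrightarrow> msq \<rho> (\<lambda>s. f s - poly_fun (p n) s) < e\<^sup>2 / 4"
      unfolding eventually_sequentially by blast
    have "dist (poly_op (p m) B v) (poly_op (p n) B v) < e" if "m \<ge> N" "n \<ge> N" for m n
    proof -
      have "(norm (poly_op (p m) B v - poly_op (p n) B v))\<^sup>2
          \<le> 2 * msq \<rho> (\<lambda>s. poly_fun (p m) s - f s) + 2 * msq \<rho> (\<lambda>s. f s - poly_fun (p n) s)"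
        unfolding isometry_diff by (intro msq_triangle L2_poly_fun f)
      also have "\<dots> < e\<^sup>2"
        using N[OF that(1)] N[OF that(2)] unfolding msq_diff_commute[of \<rho> "poly_fun (p m)"] by linarith
      finally show ?thesis
        using e unfolding dist_norm by (intro power2_less_imp_less[of _ e]) auto
    qed
    then show "\<exists>M. \<forall>m\<ge>M. \<forall>n\<ge>M. dist (poly_op (p m) B v) (poly_op (p n) B v) < e"
      by blast
  qed
  then obtain x where "(\<lambda>n. poly_op (p n) B v) \<longlonglongrightarrow> x"
    using Cauchy_convergent_iff convergent_def by blast
  with lim show ?thesis using repI by blast
qed

lemma rep_norm:
  assumes f: "f \<in> L2 \<rho>" and "rep f x"
  shows "(norm x)\<^sup>2 = msq \<rho> f"
proof -
  obtain p where p: "(\<lambda>n. msq \<rho> (\<lambda>s. f s - poly_fun (p n) s)) \<longlonglongrightarrow> 0" "(\<lambda>n. poly_op (p n) B v) \<longlonglongrightarrow> x"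
    using assms(2) unfolding rep_def by blast
  show ?thesis
  proof (rule LIMSEQ_unique)
    show "(\<lambda>n. msq \<rho> (poly_fun (p n))) \<longlonglongrightarrow> msq \<rho> f"
      by (rule msq_tendsto) (use p(1) in \<open>simp_all add: L2_poly_fun f msq_diff_commute[of _ f]\<close>)
    show "(\<lambda>n. msq \<rho> (poly_fun (p n))) \<longlonglongrightarrow> (norm x)\<^sup>2"
      unfolding isometry by (intro tendsto_intros p)
  qed
qed

lemma rep_add:
  assumes fg: "f \<in> L2 \<rho>" "g \<in> L2 \<rho>" and "rep f x" "rep g y"
  shows "rep (\<lambda>s. f s + g s) (x + y)"
proof -
  obtain p where p: "(\<lambda>n. msq \<rho> (\<lambda>s. f s - poly_fun (p n) s)) \<longlonglongrightarrow> 0" "(\<lambda>n. poly_op (p n) B v) \<longlonglongrightarrow> x"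
    using assms(3) unfolding rep_def by blast
  obtain q where q: "(\<lambda>n. msq \<rho> (\<lambda>s. g s - poly_fun (q n) s)) \<longlonglongrightarrow> 0" "(\<lambda>n. poly_op (q n) B v) \<longlonglongrightarrow> y"
    using assms(4) unfolding rep_def by blast
  have "(\<lambda>n. msq \<rho> (\<lambda>s. f s + g s - poly_fun (p n + q n) s)) \<longlonglongrightarrow> 0"
  proof (rule tendsto_sandwich[OF _ _ tendsto_const])
    have "(\<lambda>s. f s + g s - poly_fun (p n + q n) s) = (\<lambda>s. (f s - poly_fun (p n) s) + (g s - poly_fun (q n) s))" for n
      by (simp add: poly_fun_add fun_eq_iff)
    then show "\<forall>\<^sub>F n in sequentially. msq \<rho> (\<lambda>s. f s + g s - poly_fun (p n + q n) s)
        \<le> 2 * msq \<rho> (\<lambda>s. f s - poly_fun (p n) s) + 2 * msq \<rho> (\<lambda>s. g s - poly_fun (q n) s)"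
      by (simp add: msq_add_le L2_diff L2_poly_fun fg)
    show "(\<lambda>n. 2 * msq \<rho> (\<lambda>s. f s - poly_fun (p n) s) + 2 * msq \<rho> (\<lambda>s. g s - poly_fun (q n) s)) \<longlonglongrightarrow> 0"
      by (intro tendsto_add_zero tendsto_mult_right_zero p q)
  qed (simp add: msq_nonneg)
  moreover have "(\<lambda>n. poly_op (p n + q n) B v) \<longlonglongrightarrow> x + y"
    unfolding poly_op_add[OF clinear] by (intro tendsto_add p q)
  ultimately show ?thesis by (rule repI)
qed

lemma rep_scale:
  assumes "rep f x"
  shows "rep (\<lambda>s. c * f s) (c *\<^sub>C x)"
proof -
  obtain p where p: "(\<lambda>n. msq \<rho> (\<lambda>s. f s - poly_fun (p n) s)) \<longlonglongrightarrow> 0" "(\<lambda>n. poly_op (p n) B v) \<longlonglongrightarrow> x"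
    using assms unfolding rep_def by blast
  have "(\<lambda>n. msq \<rho> (\<lambda>s. c * f s - poly_fun (smult c (p n)) s)) \<longlonglongrightarrow> 0"
    unfolding poly_fun_smult right_diff_distrib[symmetric] msq_scale
    by (intro tendsto_mult_right_zero p)
  moreover have "(\<lambda>n. poly_op (smult c (p n)) B v) \<longlonglongrightarrow> c *\<^sub>C x"
    unfolding poly_op_smult[OF clinear] by (intro tendsto_scaleC p)
  ultimately show ?thesis by (rule repI)
qed

text \<open>x - y represents f - g, whose norm is 0. This yields both single-valuedness and
  independence of the representative.\<close>

lemma rep_unique:
  assumes fg: "f \<in> L2 \<rho>" "g \<in> L2 \<rho>" and "rep f x" "rep g y" and ae: "AE s in \<rho>. f s = g s"
  shows "x = y"
proof -
  have "rep (\<lambda>s. f s + (-1) * g s) (x + (-1) *\<^sub>C y)"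
    by (intro rep_add rep_scale L2_scale assms)
  then have "(norm (x + (-1) *\<^sub>C y))\<^sup>2 = msq \<rho> (\<lambda>s. f s + (-1) * g s)"
    by (intro rep_norm L2_add L2_scale fg)
  also have "\<dots> = msq \<rho> (\<lambda>_. 0)"
    by (rule msq_cong_AE) (use ae L2_measurable[OF fg(1)] L2_measurable[OF fg(2)] in auto)
  also have "\<dots> = 0" by (simp add: msq_def)
  finally show ?thesis by simp
qed

definition U :: "(real \<Rightarrow> complex) \<Rightarrow> 'a" where
  "U f = (SOME x. rep f x)"

lemma rep_U: "f \<in> L2 \<rho> \<Longrightarrow> rep f (U f)"
  unfolding U_def using rep_exists by (rule someI_ex)

lemma U_eqI: "f \<in> L2 \<rho> \<Longrightarrow> rep f x \<Longrightarrow> U f = x"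
  by (rule rep_unique[OF _ _ rep_U]) auto

lemma U_cong_AE: "f \<in> L2 \<rho> \<Longrightarrow> g \<in> L2 \<rho> \<Longrightarrow> AE s in \<rho>. f s = g s \<Longrightarrow> U f = U g"
  by (rule rep_unique[OF _ _ rep_U rep_U])

lemma U_add: "f \<in> L2 \<rho> \<Longrightarrow> g \<in> L2 \<rho> \<Longrightarrow> U (\<lambda>s. f s + g s) = U f + U g"
  by (intro U_eqI rep_add rep_U L2_add)

lemma U_scale: "f \<in> L2 \<rho> \<Longrightarrow> U (\<lambda>s. c * f s) = c *\<^sub>C U f"
  by (intro U_eqI rep_scale rep_U L2_scale)

lemma U_diff: "f \<in> L2 \<rho> \<Longrightarrow> g \<in> L2 \<rho> \<Longrightarrow> U (\<lambda>s. f s - g s) = U f - U g"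
  using U_add[of f "\<lambda>s. (-1) * g s"] U_scale[of g "-1"] L2_scale[of g \<rho> "-1"] by simp

lemma U_norm: "f \<in> L2 \<rho> \<Longrightarrow> (norm (U f))\<^sup>2 = msq \<rho> f"
  by (intro rep_norm rep_U)

lemma U_poly_fun: "U (poly_fun p) = poly_op p B v"
proof (rule U_eqI[OF L2_poly_fun])
  show "rep (poly_fun p) (poly_op p B v)"
    unfolding rep_def by (intro exI[of _ "\<lambda>_. p"]) (simp add: msq_def)
qed

lemma U_cinner:
  assumes f: "f \<in> L2 \<rho>" and g: "g \<in> L2 \<rho>"
  shows "cinner (U f) (U g) = (LINT s|\<rho>. f s * cnj (g s))"
proof -
  have "(norm (U f + c *\<^sub>C U g))\<^sup>2 = msq \<rho> (\<lambda>s. f s + c * g s)" for c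
    using f g by (simp add: L2_add L2_scale flip: U_norm U_add U_scale)
  from this[of 1] this[of "-1"] this[of \<i>] this[of "-\<i>"]
  have "4 * cinner (U f) (U g) = 4 * (LINT s|\<rho>. f s * cnj (g s))"
    unfolding cinner_polarization L2_polarization[OF assms] by simp
  then show ?thesis by simp
qed

text \<open>By the isometry, polynomials whose images converge to \<open>x\<close> are L2-Cauchy;
  completeness of L2 supplies the preimage.\<close>

lemma U_surj: "\<exists>f \<in> L2 \<rho>. U f = x"
proof -
  have "x \<in> closure (range (\<lambda>p. poly_op p B v))" by (simp add: dense)
  then obtain u where u: "\<And>n. u n \<in> range (\<lambda>p. poly_op p B v)" "u \<longlonglongrightarrow> x"
    unfolding closure_sequential by blast
  then have "\<forall>n. \<exists>p. u n = poly_op p B v" by blast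
  then obtain p where p: "\<And>n. u n = poly_op (p n) B v" by metis
  have "\<exists>g \<in> L2 \<rho>. (\<lambda>n. msq \<rho> (\<lambda>s. poly_fun (p n) s - g s)) \<longlonglongrightarrow> 0"
  proof (rule Riesz_Fischer_L2[OF finite_measure_axioms L2_poly_fun])
    fix e :: real assume e: "e > 0"
    have "Cauchy u" using u(2) by (rule LIMSEQ_imp_Cauchy)
    then obtain N where N: "\<And>m n. m \<ge> N \<Longrightarrow> n \<ge> N \<Longrightarrow> dist (u m) (u n) < sqrt e"
      using e metric_CauchyD[of u "sqrt e"] by auto
    have "msq \<rho> (\<lambda>s. poly_fun (p m) s - poly_fun (p n) s) < e" if "m \<ge> N" "n \<ge> N" for m n
    proof -
      have "(dist (u m) (u n))\<^sup>2 < (sqrt e)\<^sup>2"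
        by (intro power_strict_mono N that) auto
      then show ?thesis using e by (simp add: dist_norm p isometry_diff)
    qed
    then show "\<exists>N. \<forall>m\<ge>N. \<forall>n\<ge>N. msq \<rho> (\<lambda>s. poly_fun (p m) s - poly_fun (p n) s) < e" by blast
  qed
  then obtain g where g: "g \<in> L2 \<rho>" "(\<lambda>n. msq \<rho> (\<lambda>s. g s - poly_fun (p n) s)) \<longlonglongrightarrow> 0"
    by (auto simp: msq_diff_commute[of _ "poly_fun _"])
  have "rep g x"
    unfolding rep_def using g(2) u(2) by (auto simp flip: p)
  with g(1) show ?thesis using U_eqI by blast
qed

theorem unitary_U: "unitary_from_L2 \<rho> U"
  unfolding unitary_from_L2_def
proof (intro conjI ballI allI impI)
  show "U ` L2 \<rho> = UNIV" using U_surj by (metis UNIV_eq_I imageI)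
qed (rule U_cong_AE U_add U_scale U_cinner; assumption)+

lemma L2_times_id: "f \<in> L2 \<rho> \<Longrightarrow> (\<lambda>s. of_real s * f s) \<in> L2 \<rho>"
  by (intro L2_mult_continuous continuous_intros)

text \<open>Multiply the approximants by the variable: the bound |s| <= R preserves their L2
  convergence and continuity of \<open>B\<close> that of their images.\<close>

lemma U_times_id:
  assumes f: "f \<in> L2 \<rho>"
  shows "U (\<lambda>s. of_real s * f s) = B (U f)"
proof (rule U_eqI[OF L2_times_id[OF f]])
  obtain p where p: "(\<lambda>n. msq \<rho> (\<lambda>s. f s - poly_fun (p n) s)) \<longlonglongrightarrow> 0" "(\<lambda>n. poly_op (p n) B v) \<longlonglongrightarrow> U f"
    using rep_U[OF f] unfolding rep_def by blast
  have "(\<lambda>n. msq \<rho> (\<lambda>s. of_real s * f s - poly_fun (pCons 0 (p n)) s)) \<longlonglongrightarrow> 0"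
  proof (rule tendsto_sandwich[OF _ _ tendsto_const])
    have "(\<lambda>s. of_real s * f s - poly_fun (pCons 0 (p n)) s) = (\<lambda>s. of_real s * (f s - poly_fun (p n) s))" for n
      by (simp add: poly_fun_def fun_eq_iff right_diff_distrib)
    moreover have "msq \<rho> (\<lambda>s. of_real s * (f s - poly_fun (p n) s)) \<le> R\<^sup>2 * msq \<rho> (\<lambda>s. f s - poly_fun (p n) s)" for n
      by (intro L2_mult_bounded L2_diff L2_poly_fun f continuous_measurable continuous_intros)
        (use support in simp)
    ultimately show "\<forall>\<^sub>F n in sequentially. msq \<rho> (\<lambda>s. of_real s * f s - poly_fun (pCons 0 (p n)) s)
        \<le> R\<^sup>2 * msq \<rho> (\<lambda>s. f s - poly_fun (p n) s)" by simp
    show "(\<lambda>n. R\<^sup>2 * msq \<rho> (\<lambda>s. f s - poly_fun (p n) s)) \<longlonglongrightarrow> 0"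
      by (intro tendsto_mult_right_zero p)
  qed (simp add: msq_nonneg)
  moreover have "(\<lambda>n. poly_op (pCons 0 (p n)) B v) \<longlonglongrightarrow> B (U f)"
    using bounded_linear.tendsto[OF bounded_clinearD(1)[OF clinear] p(2)]
    by (simp add: poly_op_pCons[OF clinear])
  ultimately show "rep (\<lambda>s. of_real s * f s) (B (U f))" by (rule repI)
qed

lemma L2_times_poly: "f \<in> L2 \<rho> \<Longrightarrow> (\<lambda>s. poly_fun p s * f s) \<in> L2 \<rho>"
  unfolding poly_fun_def by (intro L2_mult_continuous continuous_intros)

lemma U_times_poly:
  assumes f: "f \<in> L2 \<rho>"
  shows "U (\<lambda>s. poly_fun p s * f s) = poly_op p B (U f)"
proof (induction p)
  case 0
  show ?case using U_scale[OF f, of 0] by (simp add: poly_fun_def)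
next
  case (pCons a p)
  have "(\<lambda>s. poly_fun (pCons a p) s * f s) = (\<lambda>s. a * f s + of_real s * (poly_fun p s * f s))"
    by (simp add: poly_fun_def fun_eq_iff algebra_simps)
  then show ?case
    using pCons.IH
    by (simp add: U_add U_scale U_times_id L2_scale L2_times_id L2_times_poly f poly_op_pCons[OF clinear])
qed

text \<open>With multiplication by \<open>\<phi>\<close> possibly unbounded, take a preimage
  \<open>g\<close> of A(Uf) instead. Then p_n tends to f and conj(p_n) phi tends to g in L2; along a
  common subsequence both hold almost everywhere, which forces g = phi conj(f) and gives membership
  in L2 as well.\<close>

lemma antilinear_multiplier:
  assumes A: "bounded_antilinear A" and comm: "\<And>x. A (B x) = B (A x)"
    and \<phi>: "\<phi> \<in> L2 \<rho>" "U \<phi> = A v" and f: "f \<in> L2 \<rho>"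
  shows "(\<lambda>s. \<phi> s * cnj (f s)) \<in> L2 \<rho>" "A (U f) = U (\<lambda>s. \<phi> s * cnj (f s))"
proof -
  have blA: "bounded_linear A" using A by (simp add: bounded_antilinear_def)
  obtain g where g: "g \<in> L2 \<rho>" "U g = A (U f)" using U_surj by blast
  obtain p where p: "(\<lambda>n. msq \<rho> (\<lambda>s. f s - poly_fun (p n) s)) \<longlonglongrightarrow> 0" "(\<lambda>n. poly_op (p n) B v) \<longlonglongrightarrow> U f"
    using rep_U[OF f] unfolding rep_def by blast
  define q where "q = (\<lambda>n. map_poly cnj (p n))"
  have q: "poly_fun (q n) s = cnj (poly_fun (p n) s)" for n s
    by (simp add: q_def poly_fun_def)
  have "msq \<rho> (\<lambda>s. poly_fun (q n) s * \<phi> s - g s) = (norm (A (poly_op (p n) B v) - A (U f)))\<^sup>2" for n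
    unfolding poly_op_antilinear[OF clinear A comm] q_def \<phi>(2)[symmetric] g(2)[symmetric]
    by (simp add: L2_diff L2_times_poly \<phi>(1) g(1) flip: U_norm U_times_poly U_diff)
  moreover have "(\<lambda>n. (norm (A (poly_op (p n) B v) - A (U f)))\<^sup>2) \<longlonglongrightarrow> (norm (A (U f) - A (U f)))\<^sup>2"
    by (intro tendsto_intros bounded_linear.tendsto[OF blA p(2)])
  ultimately have lim: "(\<lambda>n. msq \<rho> (\<lambda>s. poly_fun (q n) s * \<phi> s - g s)) \<longlonglongrightarrow> 0" by simp
  obtain r where r: "AE s in \<rho>. (\<lambda>n. f s - poly_fun (p (r n)) s) \<longlonglongrightarrow> 0
      \<and> (\<lambda>n. poly_fun (q (r n)) s * \<phi> s - g s) \<longlonglongrightarrow> 0"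
    using L2_AE_subseq[OF L2_diff[OF f L2_poly_fun] L2_diff[OF L2_times_poly[OF \<phi>(1)] g(1)] p(1) lim] by blast
  from r have ae: "AE s in \<rho>. g s = \<phi> s * cnj (f s)"
  proof eventually_elim
    case (elim s)
    have "(\<lambda>n. f s - (f s - poly_fun (p (r n)) s)) \<longlonglongrightarrow> f s - 0"
      using elim by (intro tendsto_diff tendsto_const) auto
    then have "(\<lambda>n. poly_fun (p (r n)) s) \<longlonglongrightarrow> f s" by simp
    then have "(\<lambda>n. cnj (poly_fun (p (r n)) s) * \<phi> s) \<longlonglongrightarrow> cnj (f s) * \<phi> s"
      by (intro tendsto_intros)
    moreover have "(\<lambda>n. poly_fun (q (r n)) s * \<phi> s) \<longlonglongrightarrow> g s"
      by (rule LIM_zero_cancel[OF conjunct2[OF elim]])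
    ultimately have "g s = cnj (f s) * \<phi> s"
      unfolding q by (rule LIMSEQ_unique[rotated])
    then show ?case by (simp only: mult.commute)
  qed
  have "(\<lambda>s. cnj (f s)) \<in> borel_measurable \<rho>"
    using L2_measurable[OF f] borel_measurable_continuous_onI[of cnj] continuous_on_cnj
    by (intro measurable_compose[of f \<rho> borel cnj]) (auto intro: continuous_intros)
  then have meas: "(\<lambda>s. \<phi> s * cnj (f s)) \<in> borel_measurable \<rho>"
    using L2_measurable[OF \<phi>(1)] by measurable
  show L2: "(\<lambda>s. \<phi> s * cnj (f s)) \<in> L2 \<rho>"
    by (rule L2_cong_AE[OF g(1) meas ae])
  show "A (U f) = U (\<lambda>s. \<phi> s * cnj (f s))"
    using U_cong_AE[OF g(1) L2 ae] g(2) by simp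
qed

end

text \<open>Test on the set where |f| > |g|: there |f|^2 - |g|^2 is positive but has integral 0.
  Exchanging the roles of f and g gives equality of the moduli.\<close>

lemma AE_cmod_le_if_msq_indicator_eq:
  assumes f: "f \<in> L2 \<rho>" and g: "g \<in> L2 \<rho>"
    and eq: "\<And>S. S \<in> sets \<rho> \<Longrightarrow> msq \<rho> (\<lambda>s. f s * indicator S s) = msq \<rho> (\<lambda>s. g s * indicator S s)"
  shows "AE s in \<rho>. cmod (f s) \<le> cmod (g s)"
proof -
  note [measurable] = L2_measurable[OF f] L2_measurable[OF g]
  define S where "S = {s \<in> space \<rho>. cmod (g s) < cmod (f s)}"
  have S [measurable]: "S \<in> sets \<rho>" unfolding S_def by measurable
  have sq: "(cmod (h s * indicator S s))\<^sup>2 = (cmod (h s))\<^sup>2 * indicator S s" for h :: "real \<Rightarrow> complex" and s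
    by (simp add: indicator_def)
  have int: "integrable \<rho> (\<lambda>s. (cmod (h s))\<^sup>2 * indicator S s)" if "h \<in> L2 \<rho>" for h
    using L2_integrable[OF that] by (rule integrable_real_mult_indicator[OF S])
  have nonneg: "0 \<le> ((cmod (f s))\<^sup>2 - (cmod (g s))\<^sup>2) * indicator S s" for s
    by (auto simp: S_def indicator_def intro!: power_mono)
  have "(LINT s|\<rho>. ((cmod (f s))\<^sup>2 - (cmod (g s))\<^sup>2) * indicator S s) = 0"
    using eq[OF S] int[OF f] int[OF g] unfolding msq_def sq by (simp add: left_diff_distrib)
  moreover have "integrable \<rho> (\<lambda>s. ((cmod (f s))\<^sup>2 - (cmod (g s))\<^sup>2) * indicator S s)"
    using int[OF f] int[OF g] by (simp add: left_diff_distrib)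
  ultimately have "AE s in \<rho>. ((cmod (f s))\<^sup>2 - (cmod (g s))\<^sup>2) * indicator S s = 0"
    using integral_nonneg_eq_0_iff_AE[of \<rho>] nonneg by blast
  then show ?thesis
  proof (rule AE_mp, intro AE_I2 impI)
    fix s assume s: "s \<in> space \<rho>" "((cmod (f s))\<^sup>2 - (cmod (g s))\<^sup>2) * indicator S s = 0"
    show "cmod (f s) \<le> cmod (g s)"
    proof (rule ccontr)
      assume "\<not> cmod (f s) \<le> cmod (g s)"
      then have "s \<in> S" "(cmod (g s))\<^sup>2 < (cmod (f s))\<^sup>2"
        using s(1) by (auto simp: S_def intro: power_strict_mono)
      with s(2) show False by simp
    qed
  qed
qed

section \<open>From cyclicity and the spectral measure to the model\<close>

lemma funpow_eq_poly_op:
  assumes "bounded_clinear B"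
  shows "\<exists>p. (B ^^ n) v = poly_op p B v"
proof (induction n)
  case 0
  show ?case by (intro exI[of _ "[:1:]"]) (simp add: poly_op_const)
next
  case (Suc n)
  then obtain p where "(B ^^ n) v = poly_op p B v" ..
  then show ?case
    by (intro exI[of _ "pCons 0 p"]) (simp add: poly_op_pCons[OF assms])
qed

lemma cyclic_imp_dense:
  assumes B: "bounded_clinear B" and "cyclic B v"
  shows "closure (range (\<lambda>p. poly_op p B v)) = UNIV"
proof -
  have "scaleC.subspace (range (\<lambda>p. poly_op p B v))"
    unfolding scaleC.subspace_def
  proof (intro conjI ballI allI)
    show "0 \<in> range (\<lambda>p. poly_op p B v)"
      by (intro range_eqI[of _ _ 0]) simp
    fix x y assume "x \<in> range (\<lambda>p. poly_op p B v)" "y \<in> range (\<lambda>p. poly_op p B v)"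
    then show "x + y \<in> range (\<lambda>p. poly_op p B v)"
      by (auto simp flip: poly_op_add[OF B])
  next
    fix c x assume "x \<in> range (\<lambda>p. poly_op p B v)"
    then show "c *\<^sub>C x \<in> range (\<lambda>p. poly_op p B v)"
      by (auto simp flip: poly_op_smult[OF B])
  qed
  moreover have "range (\<lambda>n. (B ^^ n) v) \<subseteq> range (\<lambda>p. poly_op p B v)"
    using funpow_eq_poly_op[OF B] by blast
  ultimately have "scaleC.span (range (\<lambda>n. (B ^^ n) v)) \<subseteq> range (\<lambda>p. poly_op p B v)"
    by (intro scaleC.span_minimal)
  then show ?thesis
    using assms(2) closure_mono unfolding cyclic_def by blast
qed

lemma fun_op_poly:
  assumes sa: "self_adjoint B"
  shows "fun_op (poly_fun p) B = poly_op p B"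
  by (rule fun_op_eqI[OF sa bounded_clinear_poly_op[OF self_adjointD(1)[OF sa]], where p = "\<lambda>_. p"])
    (simp_all add: poly_fun_def uniform_limit_const onorm_zero)

text \<open>\<open>fun_op\<close> depends on \<open>f\<close> only through the interval, where the
  zero polynomials already approximate it. This yields the support of the spectral measure.\<close>

lemma fun_op_zero:
  assumes sa: "self_adjoint B" and f: "\<And>s. s \<in> {- onorm B .. onorm B} \<Longrightarrow> f s = 0"
  shows "fun_op f B = (\<lambda>x. 0)"
proof (rule fun_op_eqI[OF sa, where p = "\<lambda>_. 0"])
  show "bounded_clinear (\<lambda>x::'a. 0 :: 'a)" by (simp add: bounded_clinear_def)
  show "uniform_limit {- onorm B .. onorm B} (\<lambda>_ s. poly 0 (complex_of_real s)) f sequentially"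
    by (rule uniform_limitI) (use f in auto)
qed (simp add: onorm_zero)

lemma spectral_measure_cyclic_model:
  assumes sa: "self_adjoint B" and cyc: "cyclic B v" and sm: "is_spectral_measure B v \<rho>"
  shows "cyclic_model \<rho> (onorm B) B v"
proof -
  have B: "bounded_clinear B" using sa by (rule self_adjointD)
  interpret finite_measure \<rho> using sm by (simp add: is_spectral_measure_def)
  have moment: "has_bochner_integral \<rho> f (cinner (fun_op f B v) v)" if "continuous_on UNIV f" for f :: "real \<Rightarrow> complex"
    using sm that by (simp add: is_spectral_measure_def)
  \<comment> \<open>Continuous, zero exactly on [-||B||, ||B||] and positive elsewhere. Since h(B) =
    0, its integral vanishes, so the measure lives on that interval.\<close>
  define h where "h = (\<lambda>s. max 0 (\<bar>s\<bar> - onorm B))"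
  have "has_bochner_integral \<rho> (\<lambda>s. complex_of_real (h s)) (cinner (fun_op (\<lambda>s. complex_of_real (h s)) B v) v)"
    unfolding h_def by (intro moment continuous_intros)
  also have "fun_op (\<lambda>s. complex_of_real (h s)) B = (\<lambda>x. 0)"
    by (rule fun_op_zero[OF sa]) (auto simp: h_def)
  finally have "has_bochner_integral \<rho> (\<lambda>s. Re (complex_of_real (h s))) (Re 0)"
    unfolding cinner_0_left by (rule has_bochner_integral_bounded_linear[OF bounded_linear_Re])
  then have "AE s in \<rho>. h s = 0"
    using integral_nonneg_eq_0_iff_AE[of \<rho> h] by (auto simp: has_bochner_integral_iff h_def)
  then have "AE s in \<rho>. \<bar>s\<bar> \<le> onorm B"
    by eventually_elim (simp add: h_def)
  then interpret compactly_supported_measure \<rho> "onorm B"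
    using sm by unfold_locales (auto simp: is_spectral_measure_def)
  show ?thesis
  proof
    show "msq \<rho> (poly_fun p) = (norm (poly_op p B v))\<^sup>2" for p
    proof -
      \<comment> \<open>On the real line \<open>q\<close> is |p|^2, while <q(B)v,v> = ||p(B)v||^2;
        the integral formula for \<open>q\<close> is the isometry.\<close>
      define q where "q = map_poly cnj p * p"
      have "has_bochner_integral \<rho> (poly_fun q) (cinner (fun_op (poly_fun q) B v) v)"
        unfolding poly_fun_def by (intro moment continuous_intros)
      moreover have "cinner (fun_op (poly_fun q) B v) v = of_real ((norm (poly_op p B v))\<^sup>2)"
        using cinner_poly_op[OF sa, of "map_poly cnj p" "poly_op p B v" v]
        unfolding fun_op_poly[OF sa] q_def poly_op_mult[OF B]
        by (simp add: map_poly_map_poly o_def cinner_self)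
      moreover have "poly_fun q = (\<lambda>s. of_real ((cmod (poly_fun p s))\<^sup>2))"
        by (simp add: q_def poly_fun_def fun_eq_iff cmod_power2_of_real mult.commute)
      ultimately have "complex_of_real (msq \<rho> (poly_fun p)) = of_real ((norm (poly_op p B v))\<^sup>2)"
        unfolding msq_def integral_complex_of_real[symmetric] by (simp add: has_bochner_integral_iff)
      then show ?thesis by (simp only: of_real_eq_iff)
    qed
  qed (use sa cyclic_imp_dense[OF B cyc] in auto)
qed

theorem proposition1p2:
  fixes A :: "'a::complex_hilbert \<Rightarrow> 'a" and v :: 'a and \<rho> :: "real measure"
  assumes "bounded_antilinear A"
    and "antilinear_symmetric A"
    and "cyclic (abs_op A) v"
    and "is_spectral_measure (abs_op A) v \<rho>"
  shows "\<exists>\<psi> \<in> borel_measurable borel. (\<forall>s::real. cmod (\<psi> s) = 1) \<and>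
    (\<exists>U. unitary_from_L2 \<rho> U \<and>
      (\<forall>p :: complex poly. (\<lambda>s. poly p (complex_of_real s)) \<in> L2 \<rho> \<and>
         U (\<lambda>s. poly p (complex_of_real s)) = poly_op p (abs_op A) v) \<and>
      (\<forall>f \<in> L2 \<rho>. model_op \<psi> f \<in> L2 \<rho> \<and> A (U f) = U (model_op \<psi> f)))"
proof -
  define B where "B = abs_op A"
  note abs = abs_op_properties[OF assms(1,2), folded B_def]
  interpret cyclic_model \<rho> "onorm B" B v
    using spectral_measure_cyclic_model abs(1) assms(3,4) unfolding B_def by blast
  \<comment> \<open>Symmetry of \<open>A\<close> and self-adjointness of \<open>B\<close> give
    <Ax,Ax> = <AAx,x> = <BBx,x> = <Bx,Bx>.\<close>
  have norm_A: "norm (A x) = norm (B x)" for x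
  proof -
    have "cinner (A x) (A x) = cinner (B x) (B x)"
      using assms(2) abs(2)[of x] self_adjointD(2)[OF abs(1), of "B x" x]
      by (simp add: antilinear_symmetric_def)
    then have "(norm (A x))\<^sup>2 = (norm (B x))\<^sup>2"
      unfolding cinner_self of_real_eq_iff .
    then show ?thesis by simp
  qed
  obtain \<phi> where \<phi>: "\<phi> \<in> L2 \<rho>" "U \<phi> = A v" using U_surj by blast
  note mult = antilinear_multiplier[OF assms(1) abs(3) \<phi>]
  have msq_eq: "msq \<rho> (\<lambda>s. \<phi> s * cnj (f s)) = msq \<rho> (\<lambda>s. of_real s * f s)" if f: "f \<in> L2 \<rho>" for f
    using norm_A[of "U f"] f mult[OF f] by (simp add: L2_times_id flip: U_norm U_times_id)
  have one: "(\<lambda>_. 1) \<in> L2 \<rho>" by (intro L2_continuous continuous_intros)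
  have id: "(\<lambda>s. complex_of_real s) \<in> L2 \<rho>" using L2_times_id[OF one] by simp
  have "msq \<rho> (\<lambda>s. \<phi> s * indicator S s) = msq \<rho> (\<lambda>s. of_real s * indicator S s)" if "S \<in> sets \<rho>" for S
  proof -
    have "indicator S \<in> L2 \<rho>"
      using poly_approx_indicator that sets_borel by (simp add: poly_approx_def)
    moreover have "cnj (indicator S s) = indicator S s" for s :: real by (simp add: indicator_def)
    ultimately show ?thesis using msq_eq[of "indicator S"] by simp
  qed
  then have "AE s in \<rho>. cmod (\<phi> s) \<le> cmod (of_real s)" "AE s in \<rho>. cmod (of_real s) \<le> cmod (\<phi> s)"
    by (intro AE_cmod_le_if_msq_indicator_eq \<phi> id; simp)+
  then have mod: "AE s in \<rho>. cmod (\<phi> s) = \<bar>s\<bar>"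
    by eventually_elim simp
  have [measurable]: "\<phi> \<in> borel_measurable borel"
    using L2_measurable[OF \<phi>(1)] measurable_cong_sets[OF sets_borel refl] by blast
  \<comment> \<open>The default 1 at s = 0 and on the exceptional null set keeps the function
    unimodular everywhere and Borel.\<close>
  define \<psi> where "\<psi> = (\<lambda>s. if cmod (\<phi> s) = \<bar>s\<bar> \<and> s \<noteq> 0 then \<phi> s / of_real s else 1)"
  have \<psi>: "\<psi> \<in> borel_measurable borel" unfolding \<psi>_def by measurable
  have model: "model_op \<psi> f \<in> L2 \<rho> \<and> A (U f) = U (model_op \<psi> f)" if f: "f \<in> L2 \<rho>" for f
  proof -
    \<comment> \<open>At s = 0 both sides vanish, because |phi(0)| = 0 wherever \<open>mod\<close>
      applies.\<close>
    have ae: "AE s in \<rho>. \<phi> s * cnj (f s) = model_op \<psi> f s"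
      using mod by eventually_elim (auto simp: model_op_def \<psi>_def)
    have "(\<lambda>s. cnj (f s)) \<in> borel_measurable \<rho>"
      using L2_measurable[OF f] borel_measurable_continuous_onI[of cnj]
      by (intro measurable_compose[of f \<rho> borel cnj]) (auto intro: continuous_intros)
    then have "model_op \<psi> f \<in> borel_measurable \<rho>"
      unfolding model_op_def using borel_imp_measurable[OF \<psi>] L2_measurable[OF id] by measurable
    then show ?thesis
      using L2_cong_AE[OF mult(1)[OF f] _ ae] U_cong_AE[OF mult(1)[OF f] _ ae] mult(2)[OF f] by simp
  qed
  show ?thesis
  proof (intro bexI[OF _ \<psi>] conjI exI[of _ U] allI ballI)
    show "cmod (\<psi> s) = 1" for s by (simp add: \<psi>_def norm_divide)
    show "unitary_from_L2 \<rho> U" by (rule unitary_U)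
    show "(\<lambda>s. poly p (complex_of_real s)) \<in> L2 \<rho>" for p
      using L2_poly_fun[of p] by (simp add: poly_fun_def)
    show "U (\<lambda>s. poly p (complex_of_real s)) = poly_op p (abs_op A) v" for p
      using U_poly_fun[of p] by (simp add: poly_fun_def B_def)
  qed (use model in auto)
qed

end
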